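(* For every positive integer $n$ and every positive divisor $k$ of $2n$, the number $o_V(\Lambda_n,k)$ of vertex orbits of $\Lambda_n$ of size $k$ equals \[ o_V(\Lambda_n, k)= \begin{cases} \displaystyle\sum_{d\mid k}\mu\!\left(\tfrac{k}{d}\right) F_{\lfloor d/2\rfloor + 2}, & k \mid n \text{ and } k \text{ odd},\\[2mm] \displaystyle\sum_{d\mid k}\mu\!\left(\tfrac{k}{d}\right) F_{\lfloor d/2\rfloor + 2} + \frac{1}{k} \sum_{d\mid k/2}\mu\!\left(\tfrac{k}{2d}\right)\Big(L_d - \tfrac{k}{2} F_{\lfloor d/2\rfloor + 2}\Big), & k \mid n \text{ and } k \text{ even},\\[2mm] \displaystyle\frac{1}{k} \sum_{d\mid k/2}\mu\!\left(\tfrac{k}{2d}\right)\Big(L_d - \tfrac{k}{2} F_{\lfloor d/2\rfloor + 2}\Big), & k\mid 2n \text{ and } k \nmid n. \end{cases} \]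
   Context: A Lucas string of length $n$ is a binary string $u_1\cdots u_n$ with no two consecutive 1s and not both $u_1=1$ and $u_n=1$. The Lucas cube $\Lambda_n$ is the subgraph of the $n$-cube $Q_n$ (binary strings of length $n$, adjacent iff they differ in exactly one position) induced by the Lucas strings of length $n$. $o_V(\Lambda_n,k)$ denotes the number of orbits of size $k$ of the natural action of the automorphism group ${\rm Aut}(\Lambda_n)$ on $V(\Lambda_n)$. $F_m$ are the Fibonacci numbers ($F_0=0$, $F_1=1$, $F_m=F_{m-1}+F_{m-2}$), $L_m$ the Lucas numbers ($L_0=2$, $L_1=1$, $L_m=L_{m-1}+L_{m-2}$), and $\mu$ is the Möbius function; sums over $d\mid m$ range over positive divisors $d$. *)

theory Defs
  imports
    "HOL-Algebra.Group_Action"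
    "HOL-Number_Theory.Fib"
    "HOL-Computational_Algebra.Squarefree"
    "Graph_Theory.Digraph_Component"
begin

text \<open>
  Binary strings are lists of Booleans, with \<open>True\<close> for the digit 1. Positions are counted
  from 0, so the digit \<open>u\<^sub>i\<close> is \<open>u ! (i - 1)\<close>. Simple graphs are symmetric digraphs without
  loops or parallel arcs, as in the locale \<open>graph\<close>.
\<close>

definition hypercube :: "nat \<Rightarrow> (bool list, bool list \<times> bool list) pre_digraph" where
  "hypercube n =
     \<lparr>verts = {u. length u = n},
      arcs = {(u, v). length u = n \<and> length v = n \<and> card {i. i < n \<and> u ! i \<noteq> v ! i} = 1},
      tail = fst,
      head = snd\<rparr>"

definition lucas_strings :: "nat \<Rightarrow> bool list set" where
  "lucas_strings n =
     {u. length u = n \<and> (\<forall>i. Suc i < n \<longrightarrow> \<not> (u ! i \<and> u ! Suc i)) \<and> \<not> (u ! 0 \<and> u ! (n - 1))}"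

text \<open>For \<open>n = 1\<close> the last condition excludes the string 1; only \<open>n \<ge> 1\<close> is meaningful.\<close>

definition lucas_cube :: "nat \<Rightarrow> (bool list, bool list \<times> bool list) pre_digraph" where
  "lucas_cube n = hypercube n \<restriction> lucas_strings n"

text \<open>
  An automorphism of a simple graph is determined by its action on the vertices. As in \<open>Bij\<close>,
  it is represented by a function that is \<open>undefined\<close> outside the vertex set.
\<close>

definition graph_auts :: "('a, 'b) pre_digraph \<Rightarrow> ('a \<Rightarrow> 'a) set" where
  "graph_auts G =
     {f \<in> Bij (verts G). \<forall>u \<in> verts G. \<forall>v \<in> verts G. u \<rightarrow>\<^bsub>G\<^esub> v \<longleftrightarrow> f u \<rightarrow>\<^bsub>G\<^esub> f v}"

definition graph_aut_group :: "('a, 'b) pre_digraph \<Rightarrow> ('a \<Rightarrow> 'a) monoid" where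
  "graph_aut_group G = BijGroup (verts G)\<lparr>carrier := graph_auts G\<rparr>"

text \<open>The natural action sends an automorphism to itself as a permutation of the vertices.\<close>

definition num_vertex_orbits :: "('a, 'b) pre_digraph \<Rightarrow> nat \<Rightarrow> nat" where
  "num_vertex_orbits G k =
     card {X \<in> orbits (graph_aut_group G) (verts G) (\<lambda>f. f). card X = k}"

fun lucas :: "nat \<Rightarrow> nat" where
  "lucas 0 = 2"
| "lucas (Suc 0) = 1"
| "lucas (Suc (Suc n)) = lucas (Suc n) + lucas n"

definition moebius_mu :: "nat \<Rightarrow> int" where
  "moebius_mu n = (if squarefree n then (- 1) ^ card (prime_factors n) else 0)"

lemma arcs_lucas_cube:
  "(u, v) \<in> arcs (lucas_cube n) \<longleftrightarrow>
     length u = n \<and> length v = n \<and> card {i. i < n \<and> u ! i \<noteq> v ! i} = 1 \<and>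
     u \<in> lucas_strings n \<and> v \<in> lucas_strings n"
  unfolding lucas_cube_def hypercube_def induce_subgraph_def
  by (simp only: pre_digraph.select_convs mem_Collect_eq prod.case fst_conv snd_conv conj_assoc)

lemma graph_lucas_cube: "graph (lucas_cube n)"
proof -
  let ?G = "lucas_cube n"
  have verts: "verts ?G = lucas_strings n" and tail: "tail ?G = fst" and head: "head ?G = snd"
    by (simp_all add: lucas_cube_def hypercube_def)
  have "finite {u :: bool list. length u = n}"
    using finite_lists_length_eq[of "UNIV :: bool set" n] by simp
  then have fin: "finite (lucas_strings n)"
    by (rule rev_finite_subset) (auto simp: lucas_strings_def)
  have sub: "arcs ?G \<subseteq> lucas_strings n \<times> lucas_strings n"
    using arcs_lucas_cube by auto
  then have finA: "finite (arcs ?G)"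
    by (rule finite_subset) (simp add: fin)
  have eq: "{i. i < n \<and> v ! i \<noteq> u ! i} = {i. i < n \<and> u ! i \<noteq> v ! i}" for u v :: "bool list"
    by auto
  have "(v, u) \<in> arcs ?G" if "(u, v) \<in> arcs ?G" for u v
    using that unfolding arcs_lucas_cube eq[of v u] by blast
  moreover have "arcs_ends ?G = arcs ?G"
    by (simp add: arcs_ends_conv tail head)
  ultimately have sym: "symmetric ?G"
    unfolding symmetric_def sym_def by blast
  have "(u, u) \<notin> arcs ?G" for u
    by (simp add: arcs_lucas_cube)
  then have irrefl: "fst e \<noteq> snd e" if "e \<in> arcs ?G" for e
    using that by (metis prod.collapse)
  show ?thesis
  proof
    show "symmetric ?G" by (rule sym)
    show "\<And>e. e \<in> arcs ?G \<Longrightarrow> tail ?G e \<in> verts ?G"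
      and "\<And>e. e \<in> arcs ?G \<Longrightarrow> head ?G e \<in> verts ?G"
      using sub by (auto simp only: verts tail head subset_iff mem_Times_iff)
    show "finite (verts ?G)" and "finite (arcs ?G)"
      using fin finA by (simp_all only: verts)
    show "tail ?G e \<noteq> head ?G e" if "e \<in> arcs ?G" for e
      unfolding tail head using that by (rule irrefl)
    show "e = e'" if "arc_to_ends ?G e = arc_to_ends ?G e'" for e e'
      using that by (simp add: arc_to_ends_def tail head prod_eq_iff)
  qed
qed

lemma subgroup_graph_auts: "subgroup (graph_auts G) (BijGroup (verts G))"
proof -
  interpret B: group "BijGroup (verts G)" by (rule group_BijGroup)
  show ?thesis
  proof (rule B.subgroupI)
    show "graph_auts G \<subseteq> carrier (BijGroup (verts G))"
      by (auto simp: graph_auts_def BijGroup_def)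
    show "graph_auts G \<noteq> {}"
      using id_Bij[of "verts G"] by (auto simp: graph_auts_def intro!: exI[of _ "\<lambda>x\<in>verts G. x"])
  next
    fix f assume f: "f \<in> graph_auts G"
    then have fB: "f \<in> Bij (verts G)" and
      fE: "\<And>u v. u \<in> verts G \<Longrightarrow> v \<in> verts G \<Longrightarrow> u \<rightarrow>\<^bsub>G\<^esub> v \<longleftrightarrow> f u \<rightarrow>\<^bsub>G\<^esub> f v"
      by (auto simp: graph_auts_def)
    have im: "f ` verts G = verts G"
      using fB by (auto simp: Bij_def bij_betw_def)
    have "u \<rightarrow>\<^bsub>G\<^esub> v \<longleftrightarrow> inv_into (verts G) f u \<rightarrow>\<^bsub>G\<^esub> inv_into (verts G) f v"
      if "u \<in> verts G" "v \<in> verts G" for u v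
      using fE[of "inv_into (verts G) f u" "inv_into (verts G) f v"] that
        Bij_inv_into_mem[OF fB] im by (simp add: f_inv_into_f)
    then show "inv\<^bsub>BijGroup (verts G)\<^esub> f \<in> graph_auts G"
      using restrict_inv_into_Bij[OF fB] by (simp add: graph_auts_def inv_BijGroup[OF fB])
  next
    fix f g assume "f \<in> graph_auts G" "g \<in> graph_auts G"
    then show "f \<otimes>\<^bsub>BijGroup (verts G)\<^esub> g \<in> graph_auts G"
      using Bij_imp_funcset[of g "verts G"]
      by (auto simp: graph_auts_def BijGroup_def compose_Bij compose_def[of _ f g] Pi_iff
          dest: compose_Bij[of f _ g])
  qed
qed

lemma group_action_graph_aut_group: "group_action (graph_aut_group G) (verts G) (\<lambda>f. f)"
proof -
  interpret B: group "BijGroup (verts G)" by (rule group_BijGroup)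
  have "group (graph_aut_group G)"
    unfolding graph_aut_group_def
    by (rule B.subgroup_imp_group[OF subgroup_graph_auts])
  moreover have "(\<lambda>f. f) \<in> hom (graph_aut_group G) (BijGroup (verts G))"
    by (auto simp: hom_def graph_aut_group_def graph_auts_def BijGroup_def)
  ultimately show ?thesis
    by (simp add: group_action_def group_hom_def group_hom_axioms_def B.is_group)
qed

end

theory Submission
  imports Defs
begin

text \<open>
  Lucas strings of length \<open>n\<close> correspond to \<open>n\<close>-periodic words on \<open>\<int>\<close> without two adjacent ones.
  The empty support is the only vertex of full degree, so every automorphism of the Lucas cube fixes
  it. It therefore preserves the number of ones and is induced by a permutation of the positions,
  which preserves adjacency on the cycle. The automorphisms thus act as the dihedral group.

  A word of least period \<open>p\<close> has a dihedral orbit of size \<open>p\<close> if it is symmetric under some reflection,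
  and \<open>2 p\<close> otherwise. There are \<open>L\<^sub>p\<close> words of period \<open>p\<close>. Counting pairs of a word of period \<open>p\<close> and
  one of the \<open>p\<close> reflections fixing it gives \<open>p F\<^bsub>p div 2 + 2\<^esub>\<close>; here a symmetric word of least period \<open>d\<close>
  occurs \<open>p / d\<close> times, so that the sum over \<open>d\<close> dividing \<open>p\<close> of the number of symmetric rotation
  classes of size \<open>d\<close> is \<open>F\<^bsub>p div 2 + 2\<^esub>\<close>. Both counts are refined to least periods by Moebius inversion.
\<close>

subsection \<open>Moebius inversion\<close>

lemma moebius_mu_prime_mult:
  assumes "prime p" "\<not> p dvd d" "squarefree d"
  shows "moebius_mu (p * d) = - moebius_mu d"
proof -
  have d: "d \<noteq> 0" using assms(2) by (metis dvd_0_right)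
  have cop: "coprime p d" using assms by (simp add: prime_imp_coprime)
  have sq: "squarefree (p * d)"
    using assms squarefree_mult_coprime[OF cop] squarefree_prime by blast
  have "prime_factors (p * d) = insert p (prime_factors d)"
    using assms d by (simp add: prime_factors_product prime_prime_factors)
  moreover have "p \<notin> prime_factors d" using assms by auto
  ultimately show ?thesis using sq assms by (simp add: moebius_mu_def)
qed

text \<open>For a prime \<open>p\<close> dividing \<open>n\<close>, the squarefree divisors of
  \<open>n\<close> pair off as \<open>d\<close> and \<open>p * d\<close> with \<open>d\<close> prime
  to \<open>p\<close>, and the two terms of each pair cancel.\<close>

lemma sum_moebius_mu:
  assumes "n > 0"
  shows "(\<Sum>d | d dvd n. moebius_mu d) = (if n = 1 then 1 else 0)"
proof (cases "n = 1")
  case True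
  then show ?thesis by (simp add: moebius_mu_def)
next
  case False
  then obtain p where p: "prime p" "p dvd n" using prime_factor_nat by blast
  define B where "B = {d. d dvd n \<and> squarefree d \<and> \<not> p dvd d}"
  have fin: "finite {d. d dvd n}" using assms by simp
  have finB: "finite B" unfolding B_def using fin by (rule rev_finite_subset) auto
  have split: "{d. d dvd n \<and> squarefree d} = B \<union> (*) p ` B"
  proof (intro equalityI subsetI)
    fix d assume d: "d \<in> {d. d dvd n \<and> squarefree d}"
    show "d \<in> B \<union> (*) p ` B"
    proof (cases "p dvd d")
      case True
      then obtain e where e: "d = p * e" by blast
      have "\<not> p dvd e"
      proof
        assume "p dvd e"
        then have "p\<^sup>2 dvd d" by (auto simp: e power2_eq_square)
        then have "p dvd 1" using d unfolding squarefree_def by blast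
        then show False using p by simp
      qed
      moreover have "squarefree e" "e dvd n"
        using d e squarefree_mono[of e d] by (auto dest: dvd_mult_right)
      ultimately show ?thesis using e by (auto simp: B_def)
    qed (use d in \<open>auto simp: B_def\<close>)
  next
    fix d assume "d \<in> B \<union> (*) p ` B"
    then show "d \<in> {d. d dvd n \<and> squarefree d}"
    proof
      assume "d \<in> (*) p ` B"
      then obtain e where e: "d = p * e" "e dvd n" "squarefree e" "\<not> p dvd e" by (auto simp: B_def)
      have "coprime p e" using e p by (simp add: prime_imp_coprime)
      moreover from this have "squarefree (p * e)"
        using e p squarefree_mult_coprime squarefree_prime by blast
      ultimately show ?thesis using e p by (simp add: divides_mult)
    qed (auto simp: B_def)
  qed
  have "(\<Sum>d | d dvd n. moebius_mu d) = (\<Sum>d | d dvd n \<and> squarefree d. moebius_mu d)"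
    by (rule sum.mono_neutral_right) (use fin in \<open>auto simp: moebius_mu_def\<close>)
  also have "\<dots> = sum moebius_mu B + sum moebius_mu ((*) p ` B)"
    unfolding split using finB by (intro sum.union_disjoint) (auto simp: B_def)
  also have "sum moebius_mu ((*) p ` B) = (\<Sum>d\<in>B. - moebius_mu d)"
  proof -
    have "inj_on ((*) p) B" using p by (auto simp: inj_on_def)
    moreover have "moebius_mu (p * d) = - moebius_mu d" if "d \<in> B" for d
      using that p by (simp add: B_def moebius_mu_prime_mult)
    ultimately show ?thesis by (simp add: sum.reindex)
  qed
  finally show ?thesis using False by (simp add: sum_negf)
qed

text \<open>After the order of summation is exchanged, \<open>f e\<close> is multiplied by the sum
  of \<open>moebius_mu\<close> over the divisors of \<open>n div e\<close>, which vanishes unless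
  \<open>e = n\<close>. Values are real because one application divides a count by
  \<open>n\<close>.\<close>

lemma moebius_inversion:
  fixes f g :: "nat \<Rightarrow> real"
  assumes fg: "\<And>m. m > 0 \<Longrightarrow> g m = (\<Sum>d | d dvd m. f d)" and n: "n > 0"
  shows "f n = (\<Sum>d | d dvd n. real_of_int (moebius_mu (n div d)) * g d)"
proof -
  have fin: "finite {d. d dvd n}" using n by simp
  have "(\<Sum>d | d dvd n. real_of_int (moebius_mu (n div d)) * g d)
      = (\<Sum>d | d dvd n. \<Sum>e | e dvd d. real_of_int (moebius_mu (n div d)) * f e)"
    using n by (intro sum.cong refl) (auto simp: fg dvd_pos_nat sum_distrib_left)
  also have "\<dots> = (\<Sum>d | d dvd n. \<Sum>e | e dvd n \<and> e dvd d. real_of_int (moebius_mu (n div d)) * f e)"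
    by (intro sum.cong refl) (auto intro: dvd_trans)
  also have "\<dots> = (\<Sum>e | e dvd n. \<Sum>d | d dvd n \<and> e dvd d. real_of_int (moebius_mu (n div d)) * f e)"
    using sum.swap_restrict[OF fin fin, of "\<lambda>d e. real_of_int (moebius_mu (n div d)) * f e" "\<lambda>d e. e dvd d"]
    by simp
  also have "\<dots> = (\<Sum>e | e dvd n. (if e = n then f e else 0))"
  proof (intro sum.cong refl)
    fix e assume "e \<in> {e. e dvd n}"
    then have e: "e dvd n" "e > 0" using n by (auto simp: dvd_pos_nat)
    have "(\<Sum>d | d dvd n \<and> e dvd d. real_of_int (moebius_mu (n div d)) * f e)
        = (\<Sum>c | c dvd n div e. real_of_int (moebius_mu c) * f e)"
    \<comment> \<open>As \<open>d\<close> runs over the multiples of \<open>e\<close> that divide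
      \<open>n\<close>, the complementary divisor \<open>n div d\<close> runs over the divisors of
      \<open>n div e\<close>.\<close>
    proof (rule sum.reindex_bij_witness[of _ "\<lambda>c. n div c" "\<lambda>d. n div d"])
      fix c assume "c \<in> {c. c dvd n div e}"
      then obtain q where q: "n = e * (c * q)" using e by (metis dvd_def dvd_mult_div_cancel mem_Collect_eq)
      then have "c > 0" "q > 0" using n by auto
      then show "n div (n div c) = c" "n div c \<in> {d. d dvd n \<and> e dvd d}"
        using q e by (auto simp: mult.left_commute[of e])
    next
      fix d assume "d \<in> {d. d dvd n \<and> e dvd d}"
      then obtain c where c: "d = e * c" and "d dvd n" by blast
      then obtain q where "n = d * q" by blast
      with c have q: "d = e * c" "n = e * (c * q)" by (simp_all add: mult.assoc)
      then have "c > 0" "q > 0" using n by auto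
      then show "n div (n div d) = d" "n div d \<in> {c. c dvd n div e}"
        "real_of_int (moebius_mu (n div d)) * f e = real_of_int (moebius_mu (n div d)) * f e"
        using q e by (auto simp flip: mult.assoc)
    qed
    also have "\<dots> = real_of_int (\<Sum>c | c dvd n div e. moebius_mu c) * f e"
      by (simp add: sum_distrib_right)
    also have "\<dots> = (if e = n then f e else 0)"
    proof -
      have "n div e > 0" using e n by (simp add: dvd_imp_le div_greater_zero_iff)
      moreover have "n div e = 1 \<longleftrightarrow> e = n" using e n by (metis div_by_1 div_self dvd_mult_div_cancel mult_1_right neq0_conv)
      ultimately show ?thesis by (simp add: sum_moebius_mu)
    qed
    finally show "(\<Sum>d | d dvd n \<and> e dvd d. real_of_int (moebius_mu (n div d)) * f e) = (if e = n then f e else 0)" .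
  qed
  also have "\<dots> = f n" using fin by (subst sum.delta) auto
  finally show ?thesis ..
qed

subsection \<open>Periodic words and their symmetries\<close>

text \<open>Words live on all of \<open>int\<close>, so that shifts and reflections are plain
  substitutions without reduction of indices, and words of different periods can be compared. Here
  \<open>n\<close> is some period, not necessarily the least. For \<open>n = 1\<close> the adjacency
  condition forbids the constant word of ones.\<close>

definition lucas_seqs ::"nat \<Rightarrow> (int \<Rightarrow> bool) set" where
  "lucas_seqs n = {f. (\<forall>i. f (i + int n) = f i) \<and> (\<forall>i. \<not> (f i \<and> f (i + 1)))}"

lemma periodic_mult:
  fixes f :: "int \<Rightarrow> 'a"
  assumes "\<And>i. f (i + p) = f i"
  shows "f (i + p * q) = f i"
proof (induction q rule: int_induct[of _ 0])
  case (step1 q)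
  then show ?case using assms[of "i + p * q"] by (simp add: algebra_simps)
next
  case (step2 q)
  then show ?case using assms[of "i + p * (q - 1)"] by (simp add: algebra_simps)
qed simp

lemma lucas_seqs_cong:
  assumes "f \<in> lucas_seqs n" "int n dvd i - j"
  shows "f i = f j"
proof -
  obtain q where "i - j = int n * q" using assms by blast
  then have "i = j + int n * q" by simp
  then show ?thesis using periodic_mult[of f "int n" j q] assms by (simp add: lucas_seqs_def)
qed

lemma lucas_seqs_mod: "f \<in> lucas_seqs n \<Longrightarrow> f (i mod int n) = f i"
  by (rule lucas_seqs_cong) (auto simp: mod_eq_dvd_iff[symmetric])

lemma lucas_seqs_sparse: "f \<in> lucas_seqs n \<Longrightarrow> \<not> (f i \<and> f (i + 1))"
  by (simp add: lucas_seqs_def)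

lemma inj_on_insert: "(\<And>S. S \<in> A \<Longrightarrow> x \<notin> S) \<Longrightarrow> inj_on (insert x) A"
  by (meson inj_onI insert_ident)

section \<open>Sparse subsets of intervals and cycles\<close>

definition sparse_sets :: "int \<Rightarrow> int \<Rightarrow> int set set" where
  "sparse_sets a b = {S. S \<subseteq> {a..<b} \<and> (\<forall>i\<in>S. i + 1 \<notin> S)}"

lemma finite_sparse_sets: "finite (sparse_sets a b)"
  by (rule finite_subset[of _ "Pow {a..<b}"]) (auto simp: sparse_sets_def)

text \<open>If the last position \<open>?b\<close> is occupied, its predecessor is not; this gives
  the Fibonacci recurrence. The offset -1 starts it at the empty intervals of formal length -1 and
  0, matching \<open>fib 1 = fib 2 = 1\<close>.\<close>

lemma card_sparse_sets_aux: "card (sparse_sets a (a + int n - 1)) = fib (Suc n)"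
proof (induction n rule: fib.induct)
  case 1
  have "sparse_sets a (a + int 0 - 1) = {{}}" by (auto simp: sparse_sets_def)
  then show ?case by simp
next
  case 2
  have "sparse_sets a (a + int (Suc 0) - 1) = {{}}" by (auto simp: sparse_sets_def)
  then show ?case by simp
next
  case (3 n)
  let ?b = "a + int n"
  have eq: "a + int (Suc (Suc n)) - 1 = ?b + 1" "a + int (Suc n) - 1 = ?b" by auto
  have "sparse_sets a (?b + 1) = sparse_sets a ?b \<union> insert ?b ` sparse_sets a (?b - 1)"
  proof (intro equalityI subsetI)
    fix S assume S: "S \<in> sparse_sets a (?b + 1)"
    show "S \<in> sparse_sets a ?b \<union> insert ?b ` sparse_sets a (?b - 1)"
    proof (cases "?b \<in> S")
      case True
      then have "?b - 1 \<notin> S" using S by (fastforce simp: sparse_sets_def)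
      have "S - {?b} \<in> sparse_sets a (?b - 1)"
      proof -
        have "x \<in> {a..<?b - 1}" if "x \<in> S - {?b}" for x
        proof -
          have "a \<le> x" "x < ?b + 1" "x \<noteq> ?b" "x \<noteq> ?b - 1"
            using S that \<open>?b - 1 \<notin> S\<close> by (auto simp: sparse_sets_def)
          then show ?thesis by auto
        qed
        then have "S - {?b} \<subseteq> {a..<?b - 1}" by blast
        then show ?thesis using S by (simp add: sparse_sets_def)
      qed
      moreover have "S = insert ?b (S - {?b})" using True by auto
      ultimately show ?thesis by blast
    next
      case False
      then have "S \<subseteq> {a..<?b}" using S
        by (auto simp: sparse_sets_def subset_iff) (metis False zle_add1_eq_le order_le_less)
      then show ?thesis using S by (auto simp: sparse_sets_def)
    qed
  next
    fix S assume "S \<in> sparse_sets a ?b \<union> insert ?b ` sparse_sets a (?b - 1)"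
    then show "S \<in> sparse_sets a (?b + 1)" by (auto simp: sparse_sets_def)
  qed
  moreover have "sparse_sets a ?b \<inter> insert ?b ` sparse_sets a (?b - 1) = {}"
    by (auto simp: sparse_sets_def)
  moreover have "card (insert ?b ` sparse_sets a (?b - 1)) = card (sparse_sets a (?b - 1))"
    by (intro card_image inj_on_insert) (auto simp: sparse_sets_def)
  ultimately have "card (sparse_sets a (?b + 1)) = card (sparse_sets a ?b) + card (sparse_sets a (?b - 1))"
    by (simp add: card_Un_disjoint finite_sparse_sets)
  then show ?case using 3 unfolding eq by simp
qed

lemma card_sparse_sets:
  assumes "a \<le> b + 1"
  shows "card (sparse_sets a b) = fib (nat (b - a + 2))"
  using card_sparse_sets_aux[of a "nat (b - a + 1)"] assms
  by (simp add: Suc_nat_eq_nat_zadd1 algebra_simps)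

lemma lucas_eq_fib: "lucas (Suc n) = fib (n + 2) + fib n"
  by (induction n rule: fib.induct) (auto simp: numeral_eq_Suc)

text \<open>These are the independent sets of the cycle of length \<open>n\<close>, the supports of
  one period of a word. For \<open>n = 1\<close> the only position is its own successor, which
  leaves the empty set.\<close>

definition cyclic_sparse_sets :: "nat \<Rightarrow> int set set" where
  "cyclic_sparse_sets n = {S. S \<subseteq> {0..<int n} \<and> (\<forall>i\<in>S. (i + 1) mod int n \<notin> S)}"

lemma
  assumes n: "n > 0"
  shows bij_betw_supp: "bij_betw (\<lambda>f. {i \<in> {0..<int n}. f i}) (lucas_seqs n) (cyclic_sparse_sets n)"
    and bij_betw_periodic_extension: "bij_betw (\<lambda>S i. i mod int n \<in> S) (cyclic_sparse_sets n) (lucas_seqs n)"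
proof -
  have 1: "\<forall>f\<in>lucas_seqs n. (\<lambda>i. i mod int n \<in> {i \<in> {0..<int n}. f i}) = f"
    using n by (auto simp: lucas_seqs_mod)
  have 2: "\<forall>S\<in>cyclic_sparse_sets n. {i \<in> {0..<int n}. i mod int n \<in> S} = S"
    by (auto simp: cyclic_sparse_sets_def)
  have 3: "(\<lambda>f. {i \<in> {0..<int n}. f i}) ` lucas_seqs n \<subseteq> cyclic_sparse_sets n"
    by (auto simp: cyclic_sparse_sets_def lucas_seqs_mod dest: lucas_seqs_sparse)
  have 4: "(\<lambda>S i. i mod int n \<in> S) ` cyclic_sparse_sets n \<subseteq> lucas_seqs n"
    by (auto simp: cyclic_sparse_sets_def lucas_seqs_def) (metis mod_add_left_eq)
  show "bij_betw (\<lambda>f. {i \<in> {0..<int n}. f i}) (lucas_seqs n) (cyclic_sparse_sets n)"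
    by (rule bij_betw_byWitness[OF 1 2 3 4])
  show "bij_betw (\<lambda>S i. i mod int n \<in> S) (cyclic_sparse_sets n) (lucas_seqs n)"
    by (rule bij_betw_byWitness[OF 2 1 4 3])
qed

text \<open>Split by position \<open>N - 1\<close>. If it is empty, a sparse subset of the path from
  0 to \<open>N - 2\<close> remains; if it is occupied, its neighbours 0 and \<open>N - 2\<close>
  are excluded and the path from 1 to \<open>N - 3\<close> remains. The two counts add up to
  \<open>fib (n + 1) + fib (n - 1)\<close>.\<close>

lemma card_lucas_seqs:
  assumes "n > 0"
  shows "card (lucas_seqs n) = lucas n"
proof -
  define N where "N = int n"
  define C where C_cyclic: "C = cyclic_sparse_sets n"
  have C_def: "C = {S. S \<subseteq> {0..<N} \<and> (\<forall>i\<in>S. (i + 1) mod N \<notin> S)}"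
    by (simp add: C_cyclic N_def cyclic_sparse_sets_def)
  have card: "card (lucas_seqs n) = card C"
    using bij_betw_supp[OF assms] by (simp add: C_cyclic bij_betw_same_card)
  show ?thesis
  proof (cases "n = 1")
    case True
    have "S = {}" if "S \<in> C" for S
    proof (rule equals0I)
      fix x assume "x \<in> S"
      then have "x = 0" "(x + 1) mod 1 \<notin> S" using that True by (auto simp: C_def N_def subset_iff)
      then show False using \<open>x \<in> S\<close> by simp
    qed
    moreover have "{} \<in> C" by (simp add: C_def)
    ultimately have "C = {{}}" by blast
    then show ?thesis using card True by simp
  next
    case False
    then have N2: "N \<ge> 2" using assms by (simp add: N_def)
    have C: "C = sparse_sets 0 (N - 1) \<union> insert (N - 1) ` sparse_sets 1 (N - 2)"
    proof (intro equalityI subsetI)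
      fix S assume "S \<in> C"
      then have S: "S \<subseteq> {0..<N}" "\<And>i. i \<in> S \<Longrightarrow> (i + 1) mod N \<notin> S" by (auto simp: C_def)
      have sp: "i + 1 \<notin> S" if "i \<in> S" for i using S(2)[OF that] S(1) that by (auto simp: subset_iff)
      show "S \<in> sparse_sets 0 (N - 1) \<union> insert (N - 1) ` sparse_sets 1 (N - 2)"
      proof (cases "N - 1 \<in> S")
        case True
        then have "0 \<notin> S" "N - 2 \<notin> S" using S(2)[of "N - 1"] sp[of "N - 2"] by auto
        have "S - {N - 1} \<in> sparse_sets 1 (N - 2)"
        proof -
          have "x \<in> {1..<N - 2}" if "x \<in> S - {N - 1}" for x
          proof -
            have "0 \<le> x" "x < N" "x \<noteq> 0" "x \<noteq> N - 1" "x \<noteq> N - 2"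
              using S(1) that \<open>0 \<notin> S\<close> \<open>N - 2 \<notin> S\<close> by auto
            then show ?thesis by auto
          qed
          then have "S - {N - 1} \<subseteq> {1..<N - 2}" by blast
          then show ?thesis using sp by (simp add: sparse_sets_def)
        qed
        moreover have "S = insert (N - 1) (S - {N - 1})" using True by auto
        ultimately show ?thesis by blast
      next
        case False
        have "x \<in> {0..<N - 1}" if "x \<in> S" for x
        proof -
          have "0 \<le> x" "x < N" "x \<noteq> N - 1" using that S(1) False by auto
          then show ?thesis by auto
        qed
        then show ?thesis using sp by (auto simp: sparse_sets_def)
      qed
    next
      fix S assume S: "S \<in> sparse_sets 0 (N - 1) \<union> insert (N - 1) ` sparse_sets 1 (N - 2)"
      have "S \<subseteq> {0..<N}" using S N2 by (auto simp: sparse_sets_def)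
      moreover have "(i + 1) mod N \<notin> S" if "i \<in> S" for i
      proof (cases "i = N - 1")
        case True
        then show ?thesis using S that N2 by (auto simp: sparse_sets_def)
      next
        case False
        then have "(i + 1) mod N = i + 1" using \<open>S \<subseteq> {0..<N}\<close> that by (auto simp: subset_iff)
        then show ?thesis using S that N2 by (auto simp: sparse_sets_def)
      qed
      ultimately show "S \<in> C" by (auto simp: C_def)
    qed
    have "sparse_sets 0 (N - 1) \<inter> insert (N - 1) ` sparse_sets 1 (N - 2) = {}"
      by (auto simp: sparse_sets_def)
    moreover have "card (insert (N - 1) ` sparse_sets 1 (N - 2)) = card (sparse_sets 1 (N - 2))"
      by (intro card_image inj_on_insert) (auto simp: sparse_sets_def)
    ultimately have "card C = card (sparse_sets 0 (N - 1)) + card (sparse_sets 1 (N - 2))"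
      unfolding C by (simp add: card_Un_disjoint finite_sparse_sets)
    also have "\<dots> = fib (n + 1) + fib (n - 1)"
      using N2 by (simp add: card_sparse_sets N_def nat_add_distrib nat_diff_distrib)
    also have "\<dots> = lucas n" using lucas_eq_fib[of "n - 1"] assms by simp
    finally show ?thesis using card by simp
  qed
qed

section \<open>Words symmetric under a reflection\<close>

lemma dvd_abs_less_double:
  fixes p x :: int
  assumes "p dvd x" "\<bar>x\<bar> < 2 * p"
  shows "x = 0 \<or> x = p \<or> x = - p"
proof -
  obtain q where q: "x = p * q" using assms(1) by blast
  have "p > 0" using assms(2) by linarith
  then have "\<bar>q\<bar> < 2" using assms(2) by (simp add: q abs_mult)
  then have "q = 0 \<or> q = 1 \<or> q = - 1" by linarith
  then show ?thesis using q by auto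
qed

text \<open>
  The reflection \<open>i \<mapsto> j - i\<close> has the two axes \<open>j / 2\<close> and \<open>(j + p) / 2\<close> modulo \<open>p\<close>. A position on an
  axis is free, whereas two adjacent positions swapped by an axis must both be 0. This leaves
  \<open>{lo..<hi}\<close> as the domain on which a symmetric word can be prescribed.
\<close>

lemma card_palindromic_lucas_seqs:
  fixes j lo hi :: int
  assumes p: "p > 0" and lo: "2 * lo = j \<or> 2 * lo = j + 3"
    and hi: "2 * hi = j + int p + 2 \<or> 2 * hi = j + int p - 1"
  shows "card {f \<in> lucas_seqs p. \<forall>i. f (j - i) = f i} = fib (nat (hi - lo + 2))"
proof -
  \<comment> \<open>If \<open>j\<close> is even, the domain starts on the axis at
    \<open>j / 2\<close>; if \<open>j\<close> is odd, the swapped pair \<open>(j - 1) / 2\<close>,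
    \<open>(j + 1) / 2\<close> is forced to 0 and the domain starts at \<open>(j + 3) / 2\<close>.
    The exclusive end \<open>hi\<close> treats the axis \<open>(j + p) / 2\<close> likewise: it is
    one past the axis, or the first member \<open>(j + p - 1) / 2\<close> of the swapped
    pair.\<close>
  define P where "P = int p"
  have P: "P \<ge> 1" using p by (simp add: P_def)
  let ?A = "{f \<in> lucas_seqs p. \<forall>i. f (j - i) = f i}"
  \<comment> \<open>The periodic symmetric extension of \<open>S\<close>: a position is occupied if
    it is congruent to some \<open>s\<close> in \<open>S\<close> or to its mirror image
    \<open>j - s\<close>.\<close>
  let ?ext = "\<lambda>S i. \<exists>s\<in>S. P dvd i - s \<or> P dvd i + s - j"
  \<comment> \<open>A multiple of \<open>P\<close> brings \<open>2 * i - j\<close> into the range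
    from 0 to \<open>2 * P\<close>, and the reflection in \<open>(j + P) / 2\<close> then brings it
    between 0 and \<open>P\<close>. A folded position outside the domain is adjacent to its own
    mirror image, hence 0 in every symmetric word.\<close>
  have fold: "\<exists>i'. lo \<le> i' \<and> i' < hi \<and> (\<forall>f\<in>?A. f i = f i') \<or> (\<forall>f\<in>?A. \<not> f i)" for i
  proof -
    define r where "r = (2 * i - j) mod (2 * P)"
    define i1 where "i1 = i - P * ((2 * i - j) div (2 * P))"
    have i1: "2 * i1 - j = r" unfolding i1_def r_def minus_mult_div_eq_mod[symmetric]
      by (simp add: algebra_simps)
    have r: "0 \<le> r" "r < 2 * P" using P by (auto simp: r_def)
    have fi1: "f i = f i1" if "f \<in> ?A" for f
      by (rule lucas_seqs_cong[of f p]) (use that in \<open>auto simp: i1_def P_def\<close>)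
    define i2 where "i2 = (if 2 * i1 \<le> j + P then i1 else j + P - i1)"
    have i2: "j \<le> 2 * i2" "2 * i2 \<le> j + P" using i1 r by (auto simp: i2_def)
    have fP: "f (j + P - i) = f i" if "f \<in> ?A" for f i
    proof -
      have "f (j + P - i) = f (j - i)"
        by (rule lucas_seqs_cong[of f p]) (use that in \<open>auto simp: P_def\<close>)
      then show ?thesis using that by simp
    qed
    have fi2: "f i = f i2" if "f \<in> ?A" for f
      using fi1[OF that] fP[OF that, of i1] by (simp add: i2_def)
    consider "lo \<le> i2 \<and> i2 < hi" | "i2 < lo" | "hi \<le> i2" by linarith
    then show ?thesis
    proof cases
      case 1
      then show ?thesis using fi2 by blast
    next
      case 2
      then have "j - i2 + 1 = i2" using lo i2 by presburger
      then have "\<not> f i2" if "f \<in> ?A" for f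
        using lucas_seqs_sparse[of f p "j - i2"] that by (metis (mono_tags, lifting) mem_Collect_eq)
      then show ?thesis using fi2 by blast
    next
      case 3
      then have "j + P - i2 = i2 + 1" using hi i2 unfolding P_def[symmetric] by presburger
      then have "\<not> f i2" if "f \<in> ?A" for f
        using lucas_seqs_sparse[of f p i2] fP[OF that, of i2] that by (metis (mono_tags, lifting) mem_Collect_eq)
      then show ?thesis using fi2 by blast
    qed
  qed
  \<comment> \<open>Every point of the domain lies on an axis or at distance at least 1 from it,
    written with doubled coordinates.\<close>
  have bound: "j \<le> 2 * s" "2 * s \<le> j + P" "2 * s = j \<or> 2 * s \<ge> j + 2" "2 * s = j + P \<or> 2 * s \<le> j + P - 2"
    if "s \<in> {lo..<hi}" for s
  proof -
    have "lo \<le> s" "s + 1 \<le> hi" using that by auto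
    with lo hi show "j \<le> 2 * s" "2 * s \<le> j + P" "2 * s = j \<or> 2 * s \<ge> j + 2"
      "2 * s = j + P \<or> 2 * s \<le> j + P - 2"
      unfolding P_def[symmetric] by presburger+
  qed
  have restr: "{i \<in> {lo..<hi}. ?ext S i} = S" if "S \<in> sparse_sets lo hi" for S
  proof (intro equalityI subsetI)
    fix i assume "i \<in> {i \<in> {lo..<hi}. ?ext S i}"
    then obtain s where i: "i \<in> {lo..<hi}" and s: "s \<in> S" "P dvd i - s \<or> P dvd i + s - j" by blast
    have s': "s \<in> {lo..<hi}" using that s by (auto simp: sparse_sets_def)
    note b = bound[OF i] bound[OF s']
    have "i = s"
      using s(2)
    proof
      assume "P dvd i - s"
      then have "i - s = 0 \<or> i - s = P \<or> i - s = - P"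
        by (rule dvd_abs_less_double) (use b P in \<open>smt (verit)\<close>)
      then show ?thesis using b P by (smt (verit))
    next
      assume "P dvd i + s - j"
      then have "i + s - j = 0 \<or> i + s - j = P \<or> i + s - j = - P"
        by (rule dvd_abs_less_double) (use b P in \<open>smt (verit)\<close>)
      then show ?thesis using b P by (smt (verit))
    qed
    then show "i \<in> S" using s by simp
  next
    fix i assume "i \<in> S"
    then show "i \<in> {i \<in> {lo..<hi}. ?ext S i}" using that by (auto simp: sparse_sets_def intro!: bexI[of _ i])
  qed
  have "bij_betw (\<lambda>f. {i \<in> {lo..<hi}. f i}) ?A (sparse_sets lo hi)"
  proof (rule bij_betw_imageI)
    show "inj_on (\<lambda>f. {i \<in> {lo..<hi}. f i}) ?A"
    proof (intro inj_onI ext)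
      fix f g i assume fg: "f \<in> ?A" "g \<in> ?A" "{i \<in> {lo..<hi}. f i} = {i \<in> {lo..<hi}. g i}"
      then have eq: "f i = g i" if "lo \<le> i" "i < hi" for i
        using that by (auto simp: set_eq_iff)
      from fold[of i] consider
        i' where "lo \<le> i'" "i' < hi" "\<forall>f\<in>?A. f i = f i'" | "\<forall>f\<in>?A. \<not> f i" by blast
      then show "f i = g i"
      proof cases
        case 1
        then have "f i = f i'" "g i = g i'" using fg(1,2) by blast+
        then show ?thesis using eq 1(1,2) by simp
      next
        case 2
        then show ?thesis using fg(1,2) by blast
      qed
    qed
    show "(\<lambda>f. {i \<in> {lo..<hi}. f i}) ` ?A = sparse_sets lo hi"
    proof (intro equalityI subsetI)
      fix S assume "S \<in> (\<lambda>f. {i \<in> {lo..<hi}. f i}) ` ?A"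
      then show "S \<in> sparse_sets lo hi"
        by (auto simp: sparse_sets_def dest: lucas_seqs_sparse)
    next
      fix S assume S: "S \<in> sparse_sets lo hi"
      have per: "?ext S (i + P) = ?ext S i" for i
      proof -
        have "P dvd i + P - s \<longleftrightarrow> P dvd i - s" "P dvd i + P + s - j \<longleftrightarrow> P dvd i + s - j" for s
          using dvd_add_left_iff[of P P "i - s"] dvd_add_left_iff[of P P "i + s - j"]
          by (simp_all add: algebra_simps)
        then show ?thesis by simp
      qed
      have sym: "?ext S (j - i) = ?ext S i" for i
      proof -
        have "P dvd j - i - s \<longleftrightarrow> P dvd i + s - j" "P dvd j - i + s - j \<longleftrightarrow> P dvd i - s" for s
          using dvd_minus_iff[of P "i + s - j"] dvd_minus_iff[of P "i - s"]
          by (simp_all add: algebra_simps)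
        then show ?thesis by auto
      qed
      have sparse: "\<not> (?ext S i \<and> ?ext S (i + 1))" for i
      proof
        assume "?ext S i \<and> ?ext S (i + 1)"
        then obtain s t where st: "s \<in> S" "t \<in> S" "P dvd i - s \<or> P dvd i + s - j"
          "P dvd i + 1 - t \<or> P dvd i + 1 + t - j" by blast
        have s': "s \<in> {lo..<hi}" and t': "t \<in> {lo..<hi}"
          using S st by (auto simp: sparse_sets_def)
        note b = bound[OF s'] bound[OF t']
        have ne: "t \<noteq> s + 1" "s \<noteq> t + 1" using S st by (auto simp: sparse_sets_def)
        \<comment> \<open>Eliminating \<open>i\<close> leaves four congruences between
          \<open>s\<close>, \<open>t\<close> and their mirror images. By \<open>bound\<close>, each
          of them is impossible or makes \<open>s\<close> and \<open>t\<close> neighbours in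
          \<open>S\<close>, against sparsity.\<close>
        have "P dvd s + 1 - t \<or> P dvd s + 1 + t - j \<or> P dvd j - s + 1 - t \<or> P dvd t + 1 - s"
        proof -
          have 1: "P dvd x - y" if "P dvd x" "P dvd y" for x y using that by simp
          show ?thesis using st(3,4)
            using 1[of "i + 1 - t" "i - s"] 1[of "i + 1 + t - j" "i - s"]
              1[of "i + 1 - t" "i + s - j"] 1[of "i + 1 + t - j" "i + s - j"]
            by (auto simp: algebra_simps)
        qed
        then show False
        proof (elim disjE)
          assume "P dvd s + 1 - t"
          then have "s + 1 - t = 0 \<or> s + 1 - t = P \<or> s + 1 - t = - P"
            by (rule dvd_abs_less_double) (use b P in \<open>smt (verit)\<close>)
          then show False using b P ne by (smt (verit))
        next
          assume "P dvd s + 1 + t - j"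
          then have "s + 1 + t - j = 0 \<or> s + 1 + t - j = P \<or> s + 1 + t - j = - P"
            by (rule dvd_abs_less_double) (use b P in \<open>smt (verit)\<close>)
          then show False using b P ne by (smt (verit))
        next
          assume "P dvd j - s + 1 - t"
          then have "j - s + 1 - t = 0 \<or> j - s + 1 - t = P \<or> j - s + 1 - t = - P"
            by (rule dvd_abs_less_double) (use b P in \<open>smt (verit)\<close>)
          then show False using b P ne by (smt (verit))
        next
          assume "P dvd t + 1 - s"
          then have "t + 1 - s = 0 \<or> t + 1 - s = P \<or> t + 1 - s = - P"
            by (rule dvd_abs_less_double) (use b P in \<open>smt (verit)\<close>)
          then show False using b P ne by (smt (verit))
        qed
      qed
      have "?ext S \<in> ?A"
        unfolding lucas_seqs_def mem_Collect_eq P_def[symmetric] using per sym sparse by blast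
      then show "S \<in> (\<lambda>f. {i \<in> {lo..<hi}. f i}) ` ?A"
        by (intro image_eqI[of _ _ "?ext S"] restr[OF S, symmetric])
    qed
  qed
  then have "card ?A = card (sparse_sets lo hi)" by (rule bij_betw_same_card)
  also have "\<dots> = fib (nat (hi - lo + 2))"
    using lo hi P by (intro card_sparse_sets) (auto simp: P_def)
  finally show ?thesis .
qed

text \<open>For odd \<open>p\<close> every reflection has one axis through a position and one
  between two positions. For \<open>p = 2 * m\<close> both axes are of the same type, which
  alternates with \<open>j\<close>; the two counts \<open>fib (m + 3)\<close> and
  \<open>fib m\<close> have mean \<open>fib (m + 2)\<close>.\<close>

lemma sum_card_palindromic_lucas_seqs:
  assumes p: "p > 0"
  shows "(\<Sum>j<p. card {f \<in> lucas_seqs p. \<forall>i. f (int j - i) = f i}) = p * fib (p div 2 + 2)"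
proof (cases "even p")
  case False
  then obtain m where m: "p = 2 * m + 1" by (auto elim: oddE)
  have "card {f \<in> lucas_seqs p. \<forall>i. f (int j - i) = f i} = fib (m + 2)" for j
  proof (cases "even j")
    case True
    then obtain c where "j = 2 * c" by (auto elim: evenE)
    then show ?thesis
      using card_palindromic_lucas_seqs[OF p, of "int c" "int j" "int (c + m)"]
      by (simp add: m nat_add_distrib)
  next
    case False
    then obtain c where "j = 2 * c + 1" by (auto elim: oddE)
    then show ?thesis
      using card_palindromic_lucas_seqs[OF p, of "int (c + 2)" "int j" "int (c + m + 2)"]
      by (simp add: m nat_add_distrib)
  qed
  then show ?thesis by (simp add: m)
next
  case True
  then obtain m where m: "p = 2 * m" by (auto elim: evenE)
  have ev: "card {f \<in> lucas_seqs p. \<forall>i. f (int (2 * c) - i) = f i} = fib (m + 3)" for c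
    using card_palindromic_lucas_seqs[OF p, of "int c" "int (2 * c)" "int (c + m + 1)"]
    by (simp add: m nat_add_distrib add.commute)
  have od: "card {f \<in> lucas_seqs p. \<forall>i. f (int (2 * c + 1) - i) = f i} = fib m" for c
    using card_palindromic_lucas_seqs[OF p, of "int (c + 2)" "int (2 * c + 1)" "int (c + m)"] p
    by (simp add: m)
  have "(\<Sum>j<2 * k. card {f \<in> lucas_seqs p. \<forall>i. f (int j - i) = f i}) = k * (fib (m + 3) + fib m)" for k
    by (induction k) (use ev od in \<open>simp_all add: algebra_simps\<close>)
  moreover have "fib (m + 3) + fib m = 2 * fib (m + 2)" by (simp add: numeral_eq_Suc)
  ultimately show ?thesis by (simp add: m)
qed

subsection \<open>Least periods and dihedral orbits\<close>

text \<open>The periods of a word form a subgroup of the integers, and \<open>p\<close> is its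
  nonnegative generator. For \<open>p > 0\<close> it is the least positive period;
  \<open>p = 0\<close> stands for aperiodic words.\<close>

definition primitive_seqs :: "nat \<Rightarrow> (int \<Rightarrow> bool) set" where
  "primitive_seqs p =
     {f. (\<forall>t. (\<forall>i. f (i + t) = f i) \<longleftrightarrow> int p dvd t) \<and> (\<forall>i. \<not> (f i \<and> f (i + 1)))}"

lemma primitive_seqs_shift: "f \<in> primitive_seqs p \<Longrightarrow> (\<forall>i. f (i + t) = f i) \<longleftrightarrow> int p dvd t"
  by (simp add: primitive_seqs_def)

lemma primitive_seqs_in_lucas_seqs: "f \<in> primitive_seqs p \<Longrightarrow> f \<in> lucas_seqs n \<longleftrightarrow> p dvd n"
  using primitive_seqs_shift[of f p "int n"] by (auto simp: primitive_seqs_def lucas_seqs_def)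

lemma primitive_seqs_unique: "f \<in> primitive_seqs p \<Longrightarrow> f \<in> primitive_seqs q \<Longrightarrow> p = q"
  using primitive_seqs_shift[of f p] primitive_seqs_shift[of f q]
  by (metis dvd_antisym dvd_refl int_dvd_int_iff)

text \<open>The least positive period \<open>p\<close> divides every period \<open>t\<close>,
  because \<open>t mod p\<close> is again a period and smaller than \<open>p\<close>.\<close>

lemma lucas_seqs_primitive:
  assumes "f \<in> lucas_seqs n" "n > 0"
  obtains p where "p dvd n" "f \<in> primitive_seqs p"
proof -
  define p where "p = (LEAST p. p > 0 \<and> f \<in> lucas_seqs p)"
  have "p > 0 \<and> f \<in> lucas_seqs p" unfolding p_def by (rule LeastI[of _ n]) (use assms in auto)
  then have p: "p > 0" "f \<in> lucas_seqs p" by auto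
  have "int p dvd t" if t: "\<forall>i. f (i + t) = f i" for t
  proof -
    define r where "r = t mod int p"
    have "f (i + r) = f i" for i
    proof -
      have "f (i + r) = f (i + t)"
        by (rule lucas_seqs_cong[OF p(2)]) (simp add: r_def mod_eq_dvd_iff[symmetric])
      then show ?thesis using t by simp
    qed
    moreover have r: "0 \<le> r" "r < int p" using p by (auto simp: r_def)
    ultimately have "f \<in> lucas_seqs (nat r)" using p by (simp add: lucas_seqs_def)
    then have "r = 0" using not_less_Least[of "nat r" "\<lambda>p. p > 0 \<and> f \<in> lucas_seqs p"] r
      by (auto simp flip: p_def)
    then show ?thesis by (auto simp: r_def)
  qed
  moreover have "f (i + t) = f i" if "int p dvd t" for i t
    by (rule lucas_seqs_cong[OF p(2)]) (use that in simp)
  ultimately have "f \<in> primitive_seqs p"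
    using p(2) by (auto simp: primitive_seqs_def lucas_seqs_def)
  moreover from this have "p dvd n" using assms primitive_seqs_in_lucas_seqs by blast
  ultimately show ?thesis using that by blast
qed

lemma finite_lucas_seqs:
  assumes "n > 0"
  shows "finite (lucas_seqs n)"
proof (rule inj_on_finite[of "\<lambda>f. {i \<in> {0..<int n}. f i}" _ "Pow {0..<int n}"])
  show "inj_on (\<lambda>f. {i \<in> {0..<int n}. f i}) (lucas_seqs n)"
  proof (intro inj_onI ext)
    fix f g i assume fg: "f \<in> lucas_seqs n" "g \<in> lucas_seqs n"
      "{i \<in> {0..<int n}. f i} = {i \<in> {0..<int n}. g i}"
    have "i mod int n \<in> {i \<in> {0..<int n}. f i} \<longleftrightarrow> i mod int n \<in> {i \<in> {0..<int n}. g i}"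
      using fg(3) by simp
    then show "f i = g i" using assms by (simp add: lucas_seqs_mod[OF fg(1)] lucas_seqs_mod[OF fg(2)])
  qed
qed auto

lemma finite_primitive_seqs: "p > 0 \<Longrightarrow> finite (primitive_seqs p)"
  using finite_lucas_seqs primitive_seqs_in_lucas_seqs
  by (metis dvd_refl finite_subset subsetI)

lemma lucas_seqs_eq_UN:
  assumes "n > 0"
  shows "lucas_seqs n = (\<Union>d\<in>{d. d dvd n}. primitive_seqs d)"
  using lucas_seqs_primitive[OF _ assms] primitive_seqs_in_lucas_seqs by blast

definition achiral :: "(int \<Rightarrow> bool) \<Rightarrow> bool" where
  "achiral f \<longleftrightarrow> (\<exists>t. \<forall>i. f (t - i) = f i)"

definition achiral_seqs :: "nat \<Rightarrow> (int \<Rightarrow> bool) set" where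
  "achiral_seqs p = {f \<in> primitive_seqs p. achiral f}"

text \<open>Sorting the words of period \<open>m\<close> by least period writes
  \<open>lucas m\<close> as a divisor sum, which is then inverted.\<close>

lemma card_primitive_seqs:
  assumes "n > 0"
  shows "real (card (primitive_seqs n)) =
    (\<Sum>d | d dvd n. real_of_int (moebius_mu (n div d)) * real (lucas d))"
proof (rule moebius_inversion[OF _ assms,
      where f = "\<lambda>n. real (card (primitive_seqs n))" and g = "\<lambda>n. real (lucas n)"])
  fix m :: nat assume m: "m > 0"
  have fin: "finite (primitive_seqs d)" if "d dvd m" for d
    using that m by (intro finite_primitive_seqs) (simp add: dvd_pos_nat)
  have "card (lucas_seqs m) = (\<Sum>d | d dvd m. card (primitive_seqs d))"
    unfolding lucas_seqs_eq_UN[OF m]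
    using m fin by (intro card_UN_disjoint) (auto dest: primitive_seqs_unique)
  then show "real (lucas m) = (\<Sum>d | d dvd m. real (card (primitive_seqs d)))"
    by (simp add: card_lucas_seqs[OF m])
qed

text \<open>Composing two reflections that fix \<open>f\<close> gives the shift by
  \<open>j - c\<close>. The reflections fixing an achiral word thus form one coset of its group of
  periods.\<close>

lemma reflection_axes:
  assumes f: "f \<in> primitive_seqs d" and c: "\<forall>i. f (c - i) = f i"
  shows "(\<forall>i. f (j - i) = f i) \<longleftrightarrow> int d dvd j - c"
proof -
  have "(\<forall>i. f (j - i) = f i) \<longleftrightarrow> (\<forall>i. f (i + (j - c)) = f i)"
  proof (rule iffI; rule allI)
    fix i assume "\<forall>i. f (j - i) = f i"
    then have "f (j - (c - i)) = f (c - i)" by blast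
    then show "f (i + (j - c)) = f i" using c by (simp add: algebra_simps)
  next
    fix i assume "\<forall>i. f (i + (j - c)) = f i"
    then have "f (c - i + (j - c)) = f (c - i)" by blast
    then show "f (j - i) = f i" using c by (simp add: algebra_simps)
  qed
  then show ?thesis using primitive_seqs_shift[OF f] by simp
qed

lemma card_cong_class:
  assumes "d > 0" "d dvd p"
  shows "card {j. j < p \<and> int d dvd int j - c} = p div d"
proof -
  define r where "r = nat (c mod int d)"
  have r: "r < d" "int r = c mod int d" using assms by (auto simp: r_def nat_less_iff)
  have dvd: "int d dvd int j - c \<longleftrightarrow> j mod d = r" for j
  proof -
    have "int d dvd int j - c \<longleftrightarrow> int (j mod d) = int r"
      unfolding r(2) zmod_int by (simp add: mod_eq_dvd_iff)
    then show ?thesis by simp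
  qed
  have "bij_betw (\<lambda>q. q * d + r) {..<p div d} {j. j < p \<and> int d dvd int j - c}"
  proof (rule bij_betw_byWitness[where f' = "\<lambda>j. j div d"])
    show "(\<lambda>q. q * d + r) ` {..<p div d} \<subseteq> {j. j < p \<and> int d dvd int j - c}"
    proof -
      have "q * d + r < p" if q: "q < p div d" for q
      proof -
        have "q * d + r < (q + 1) * d" using r by simp
        also have "\<dots> \<le> (p div d) * d" using q by (intro mult_le_mono1) simp
        finally show ?thesis using assms by simp
      qed
      then show ?thesis using r(1) unfolding dvd by auto
    qed
    show "(\<lambda>j. j div d) ` {j. j < p \<and> int d dvd int j - c} \<subseteq> {..<p div d}"
      using assms by (auto simp: div_less_iff_less_mult)
    show "\<forall>j\<in>{j. j < p \<and> int d dvd int j - c}. j div d * d + r = j"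
      using r by (auto simp: dvd)
    show "\<forall>q\<in>{..<p div d}. (q * d + r) div d = q"
      using r by simp
  qed
  then show ?thesis using bij_betw_same_card by fastforce
qed

text \<open>Pairs of a word of period \<open>m\<close> and a reflection \<open>j < m\<close> fixing
  it are counted in two ways. A word of least period \<open>d\<close> is fixed by
  \<open>m div d\<close> of these reflections, so dividing by \<open>m\<close> writes
  \<open>fib (m div 2 + 2)\<close> as the sum of \<open>card (achiral_seqs d) / d\<close>.\<close>

lemma card_achiral_seqs:
  assumes "n > 0"
  shows "real (card (achiral_seqs n)) =
    real n * (\<Sum>d | d dvd n. real_of_int (moebius_mu (n div d)) * real (fib (d div 2 + 2)))"
proof -
  have "real (card (achiral_seqs n)) / real n =
    (\<Sum>d | d dvd n. real_of_int (moebius_mu (n div d)) * real (fib (d div 2 + 2)))"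
  proof (rule moebius_inversion[OF _ assms, 
        where f = "\<lambda>n. real (card (achiral_seqs n)) / real n"
          and g = "\<lambda>n. real (fib (n div 2 + 2))"])
    fix m :: nat assume m: "m > 0"
    have pos: "d > 0" if "d dvd m" for d using that m by (simp add: dvd_pos_nat)
    define A where "A = (\<Union>d\<in>{d. d dvd m}. achiral_seqs d)"
    have finA: "finite (achiral_seqs d)" if "d dvd m" for d
      using finite_primitive_seqs[OF pos[OF that]] by (simp add: achiral_seqs_def)
    have A: "A = {f \<in> lucas_seqs m. achiral f}"
      by (auto simp: A_def lucas_seqs_eq_UN[OF m] achiral_seqs_def)
    have fin: "finite A" using m finA by (auto simp: A_def)
    have "m * fib (m div 2 + 2) = (\<Sum>j<m. card {f \<in> A. \<forall>i. f (int j - i) = f i})"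
      unfolding sum_card_palindromic_lucas_seqs[OF m, symmetric]
      by (intro sum.cong refl arg_cong[of _ _ card]) (auto simp: A achiral_def)
    also have "\<dots> = (\<Sum>j<m. \<Sum>f\<in>A. if \<forall>i. f (int j - i) = f i then 1 else 0)"
      using fin by (simp add: sum.If_cases Int_def)
    also have "\<dots> = (\<Sum>f\<in>A. \<Sum>j<m. if \<forall>i. f (int j - i) = f i then 1 else 0)"
      by (rule sum.swap)
    also have "\<dots> = (\<Sum>f\<in>A. card {j. j < m \<and> (\<forall>i. f (int j - i) = f i)})"
      by (simp add: sum.If_cases Int_def)
    also have "\<dots> = (\<Sum>d | d dvd m. \<Sum>f\<in>achiral_seqs d. card {j. j < m \<and> (\<forall>i. f (int j - i) = f i)})"
      unfolding A_def
      using m finA by (intro sum.UNION_disjoint) (auto simp: achiral_seqs_def dest: primitive_seqs_unique)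
    also have "\<dots> = (\<Sum>d | d dvd m. \<Sum>f\<in>achiral_seqs d. m div d)"
    proof (intro sum.cong refl)
      fix d f assume d: "d \<in> {d. d dvd m}" and f: "f \<in> achiral_seqs d"
      then obtain c where c: "\<forall>i. f (c - i) = f i" and fp: "f \<in> primitive_seqs d"
        by (auto simp: achiral_seqs_def achiral_def)
      show "card {j. j < m \<and> (\<forall>i. f (int j - i) = f i)} = m div d"
        unfolding reflection_axes[OF fp c] using d pos by (intro card_cong_class) auto
    qed
    finally have "real (m * fib (m div 2 + 2)) = real (\<Sum>d | d dvd m. card (achiral_seqs d) * (m div d))"
      by simp
    also have "\<dots> = real m * (\<Sum>d | d dvd m. real (card (achiral_seqs d)) / real d)"
      unfolding of_nat_sum sum_distrib_left
      by (intro sum.cong refl) (auto simp: real_of_nat_div)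
    finally show "real (fib (m div 2 + 2)) = (\<Sum>d | d dvd m. real (card (achiral_seqs d)) / real d)"
      using m by simp
  qed
  then show ?thesis using assms by (simp add: field_simps)
qed

text \<open>The maps \<open>i \<mapsto> e * i + t\<close> form the infinite dihedral group. It acts
  on words of period \<open>n\<close> through the symmetries of the \<open>n\<close>-cycle, so the
  orbit can be defined without reference to \<open>n\<close>.\<close>

definition dihedral_orbit :: "(int \<Rightarrow> bool) \<Rightarrow> (int \<Rightarrow> bool) set" where
  "dihedral_orbit f = {(\<lambda>i. f (e * i + t)) |e t. e \<in> {1, - 1}}"

lemma dihedral_orbit_eq: "dihedral_orbit f = range (\<lambda>t i. f (i + t)) \<union> range (\<lambda>t i. f (t - i))"
  by (auto simp: dihedral_orbit_def image_iff add.commute conj_disj_distribL ex_disj_distrib)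

text \<open>There are \<open>p\<close> distinct shifts, and the reflected words are their mirror
  images, hence again \<open>p\<close> in number. A shift equal to a reflected word makes
  \<open>f\<close> achiral, and for achiral \<open>f\<close> every reflected word is a shift; so the
  two families coincide or are disjoint.\<close>

lemma card_dihedral_orbit:
  assumes f: "f \<in> primitive_seqs p" and p: "p > 0"
  shows "card (dihedral_orbit f) = (if achiral f then p else 2 * p)"
proof -
  have sh: "(\<lambda>i. f (i + s)) = (\<lambda>i. f (i + t)) \<longleftrightarrow> int p dvd s - t" for s t
  proof -
    have "(\<lambda>i. f (i + s)) = (\<lambda>i. f (i + t)) \<longleftrightarrow> (\<forall>i. f (i + (s - t)) = f i)"
    proof
      assume eq: "(\<lambda>i. f (i + s)) = (\<lambda>i. f (i + t))"
      show "\<forall>i. f (i + (s - t)) = f i"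
        using fun_cong[OF eq, of "i - t" for i] by (simp add: algebra_simps)
    next
      assume eq: "\<forall>i. f (i + (s - t)) = f i"
      show "(\<lambda>i. f (i + s)) = (\<lambda>i. f (i + t))"
      proof
        fix i show "f (i + s) = f (i + t)" using eq[rule_format, of "i + t"] by (simp add: algebra_simps)
      qed
    qed
    then show ?thesis using primitive_seqs_shift[OF f] by simp
  qed
  let ?rot = "\<lambda>t i. f (i + t)" and ?ref = "\<lambda>t i. f (t - i)"
  have rot: "range ?rot = ?rot ` {0..<int p}"
  proof -
    have "?rot t \<in> ?rot ` {0..<int p}" for t
    proof -
      have "?rot t = ?rot (t mod int p)" unfolding sh by (simp add: mod_eq_dvd_iff[symmetric])
      then show ?thesis using p by (intro image_eqI[of _ _ "t mod int p"]) auto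
    qed
    then show ?thesis by blast
  qed
  have "inj_on ?rot {0..<int p}"
    by (rule inj_onI) (auto simp: sh mod_eq_dvd_iff[symmetric])
  then have card: "card (range ?rot) = p" unfolding rot by (simp add: card_image)
  have fin: "finite (range ?rot)" unfolding rot by simp
  have ref: "range ?ref = (\<lambda>g i. g (- i)) ` range ?rot"
    by (auto simp: image_iff add.commute)
  have "inj (\<lambda>(g :: int \<Rightarrow> bool) i. g (- i))"
  proof (intro injI ext)
    fix x y :: "int \<Rightarrow> bool" and i assume eq: "(\<lambda>i. x (- i)) = (\<lambda>i. y (- i))"
    show "x i = y i" using fun_cong[OF eq, of "- i"] by simp
  qed
  then have card2: "card (range ?ref) = p" "finite (range ?ref)"
    unfolding ref using card fin by (simp_all add: card_image inj_on_subset[OF _ subset_UNIV])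
  show ?thesis
  proof (cases "achiral f")
    case True
    then obtain c where c: "\<And>i. f (c - i) = f i" by (auto simp: achiral_def)
    have "?ref t = ?rot (c - t)" for t
    proof
      fix i show "f (t - i) = f (i + (c - t))" using c[of "t - i"] by (simp add: algebra_simps)
    qed
    then have "range ?ref \<subseteq> range ?rot" by auto
    then show ?thesis using True card by (simp add: dihedral_orbit_eq Un_absorb2)
  next
    case False
    have "?rot s \<noteq> ?ref t" for s t
    proof
      assume eq: "?rot s = ?ref t"
      have "f (t + s - i) = f i" for i
        using fun_cong[OF eq, of "i - s"] by (simp add: algebra_simps)
      then show False using False by (auto simp: achiral_def)
    qed
    then have "range ?rot \<inter> range ?ref = {}" by auto
    then show ?thesis using False card card2 fin by (simp add: dihedral_orbit_eq card_Un_disjoint)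
  qed
qed

text \<open>Orbit size \<open>k\<close> means an achiral word of least period \<open>k\<close> or a
  chiral one of least period \<open>k div 2\<close>. The first needs \<open>k dvd n\<close>; for the
  second, \<open>k dvd 2 * n\<close> already yields \<open>k div 2 dvd n\<close>.\<close>

lemma card_lucas_seqs_orbit_size:
  assumes n: "n > 0" and k: "k dvd 2 * n"
  shows "card {f \<in> lucas_seqs n. card (dihedral_orbit f) = k} =
    (if k dvd n then card (achiral_seqs k) else 0) +
    (if even k then card (primitive_seqs (k div 2)) - card (achiral_seqs (k div 2)) else 0)"
proof -
  have k0: "k > 0" using n k dvd_pos_nat[of "2 * n" k] by simp
  let ?A = "if k dvd n then achiral_seqs k else {}"
  let ?B = "if even k then primitive_seqs (k div 2) - achiral_seqs (k div 2) else {}"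
  have pos: "p > 0" if "p dvd n" for p using that n by (simp add: dvd_pos_nat)
  have half: "k div 2 dvd n" "k div 2 > 0" if "even k" using that k k0 by auto
  have "{f \<in> lucas_seqs n. card (dihedral_orbit f) = k} = ?A \<union> ?B"
  proof (intro equalityI subsetI)
    fix f assume "f \<in> {f \<in> lucas_seqs n. card (dihedral_orbit f) = k}"
    then have f: "f \<in> lucas_seqs n" "card (dihedral_orbit f) = k" by auto
    obtain p where p: "p dvd n" "f \<in> primitive_seqs p" using lucas_seqs_primitive[OF f(1) n] .
    show "f \<in> ?A \<union> ?B"
      using card_dihedral_orbit[OF p(2) pos[OF p(1)]] p f(2) by (auto simp: achiral_seqs_def split: if_splits)
  next
    fix f assume "f \<in> ?A \<union> ?B"
    then show "f \<in> {f \<in> lucas_seqs n. card (dihedral_orbit f) = k}"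
      using card_dihedral_orbit[of f k] card_dihedral_orbit[of f "k div 2"] half k0
        primitive_seqs_in_lucas_seqs[of f k n] primitive_seqs_in_lucas_seqs[of f "k div 2" n]
      by (auto simp: achiral_seqs_def split: if_splits)
  qed
  moreover have "?A \<inter> ?B = {}"
  proof -
    have "k \<noteq> k div 2" using k0 by simp
    then show ?thesis by (auto simp: achiral_seqs_def dest: primitive_seqs_unique split: if_splits)
  qed
  moreover have "finite ?A" "finite ?B"
    using finite_primitive_seqs k0 half by (auto simp: achiral_seqs_def)
  ultimately have "card {f \<in> lucas_seqs n. card (dihedral_orbit f) = k} = card ?A + card ?B"
    by (simp add: card_Un_disjoint)
  moreover have "card ?B = (if even k then card (primitive_seqs (k div 2)) - card (achiral_seqs (k div 2)) else 0)"
    using half finite_primitive_seqs[of "k div 2"]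
    by (auto simp: achiral_seqs_def intro!: card_Diff_subset)
  ultimately show ?thesis by simp
qed

subsection \<open>Automorphisms\<close>

definition set_adj :: "'a set \<Rightarrow> 'a set \<Rightarrow> bool" where
  "set_adj A B \<longleftrightarrow> (\<exists>x. x \<notin> A \<and> B = insert x A) \<or> (\<exists>x. x \<notin> B \<and> A = insert x B)"

lemma set_adj_insert: "x \<notin> A \<Longrightarrow> set_adj A (insert x A)"
  by (auto simp: set_adj_def)

text \<open>The symmetric difference is the set of positions where the characteristic words differ,
  so this links \<open>set_adj\<close> to adjacency in the cube.\<close>

lemma set_adj_iff_card: "set_adj A B \<longleftrightarrow> card ((A - B) \<union> (B - A)) = 1"
proof
  assume "set_adj A B"
  then consider x where "x \<notin> A" "B = insert x A" | x where "x \<notin> B" "A = insert x B"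
    unfolding set_adj_def by blast
  then show "card ((A - B) \<union> (B - A)) = 1"
    by cases (simp_all add: insert_Diff_if)
next
  assume "card ((A - B) \<union> (B - A)) = 1"
  then obtain x where x: "(A - B) \<union> (B - A) = {x}" by (rule card_1_singletonE)
  have eq: "y \<in> A \<longleftrightarrow> y \<in> B" if "y \<noteq> x" for y
  proof -
    have "y \<notin> (A - B) \<union> (B - A)" using that x by simp
    then show ?thesis by blast
  qed
  have "x \<in> (A - B) \<union> (B - A)" using x by simp
  then consider "x \<notin> A" "x \<in> B" | "x \<notin> B" "x \<in> A" by auto
  then show "set_adj A B"
  proof cases
    case 1
    then have "y \<in> B \<longleftrightarrow> y \<in> insert x A" for y using eq[of y] by (cases "y = x") auto
    then have "B = insert x A" by blast
    then show ?thesis using 1 by (auto simp: set_adj_def)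
  next
    case 2
    then have "y \<in> A \<longleftrightarrow> y \<in> insert x B" for y using eq[of y] by (cases "y = x") auto
    then have "A = insert x B" by blast
    then show ?thesis using 2 by (auto simp: set_adj_def)
  qed
qed

text \<open>When \<open>S\<close> is built from the empty set one element at a time, each step
  changes the image by one element, so its cardinality grows by at most 1. The bound serves both an
  automorphism and its inverse.\<close>

lemma card_image_adj_le:
  assumes down: "\<And>S T. S \<in> \<F> \<Longrightarrow> T \<subseteq> S \<Longrightarrow> T \<in> \<F>"
    and fin: "\<And>S. S \<in> \<F> \<Longrightarrow> finite S"
    and maps: "\<And>S. S \<in> \<F> \<Longrightarrow> F S \<in> \<F>"
    and adj: "\<And>S T. S \<in> \<F> \<Longrightarrow> T \<in> \<F> \<Longrightarrow> set_adj S T \<Longrightarrow> set_adj (F S) (F T)"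
    and empty: "F {} = {}" and S: "S \<in> \<F>"
  shows "card (F S) \<le> card S"
  using fin[OF S] S
proof (induction S rule: finite_induct)
  case empty
  then show ?case by (simp add: assms(5))
next
  case (insert x T)
  have T: "T \<in> \<F>" using down[OF insert.prems] by blast
  have "set_adj (F T) (F (insert x T))"
    using adj[OF T insert.prems set_adj_insert] insert.hyps by blast
  moreover have "finite (F T)" "finite (F (insert x T))" using fin maps T insert.prems by blast+
  ultimately have "card (F (insert x T)) \<le> Suc (card (F T))"
    by (auto simp: set_adj_def card_insert_if)
  then show ?case using insert.IH[OF T] insert.hyps by simp
qed

text \<open>Cardinality is the distance from the empty set, hence preserved. A set adjacent to a
  smaller one contains it, so \<open>F\<close> is monotone. It sends singletons to distinct
  singletons, and comparing cardinalities identifies \<open>F S\<close> with their union.\<close>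

lemma down_closed_family_automorphism:
  assumes down: "\<And>S T. S \<in> \<F> \<Longrightarrow> T \<subseteq> S \<Longrightarrow> T \<in> \<F>"
    and fin: "\<And>S. S \<in> \<F> \<Longrightarrow> finite S"
    and bij: "bij_betw F \<F> \<F>"
    and adj: "\<And>S T. S \<in> \<F> \<Longrightarrow> T \<in> \<F> \<Longrightarrow> set_adj S T \<longleftrightarrow> set_adj (F S) (F T)"
    and empty: "F {} = {}" and S: "S \<in> \<F>"
  shows "card (F S) = card S" and "F S = (\<Union>x\<in>S. F {x})"
proof -
  have maps: "F T \<in> \<F>" if "T \<in> \<F>" for T using bij that by (auto simp: bij_betw_def)
  have inv: "F (inv_into \<F> F T) = T" "inv_into \<F> F T \<in> \<F>" if "T \<in> \<F>" for T
    using bij that by (auto simp: bij_betw_def f_inv_into_f inv_into_into)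
  have inv': "inv_into \<F> F (F T) = T" if "T \<in> \<F>" for T
    using bij that by (simp add: bij_betw_def)
  have card: "card (F T) = card T" if T: "T \<in> \<F>" for T
  proof (rule antisym)
    show "card (F T) \<le> card T"
      by (rule card_image_adj_le[of \<F> F]) (use down fin maps adj empty T in blast)+
    have "{} \<in> \<F>" using down[OF T] by blast
    then have inv_empty: "inv_into \<F> F {} = {}" using inv'[of "{}"] empty by simp
    have inv_adj: "set_adj (inv_into \<F> F S) (inv_into \<F> F T)"
      if "S \<in> \<F>" "T \<in> \<F>" "set_adj S T" for S T
      using adj[OF inv(2) inv(2)] inv(1) that by simp
    have "card (inv_into \<F> F (F T)) \<le> card (F T)"
      by (rule card_image_adj_le[of \<F> "inv_into \<F> F"])
        (use down fin inv(2) inv_adj inv_empty maps[OF T] in blast)+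
    then show "card T \<le> card (F T)" using inv'[OF T] by simp
  qed
  show "card (F S) = card S" by (rule card[OF S])
  have step: "F T \<subseteq> F (insert x T)" if "insert x T \<in> \<F>" for x T
  proof (cases "x \<in> T")
    case False
    have T: "T \<in> \<F>" using down[OF that] by blast
    have "card (F (insert x T)) = Suc (card (F T))"
      using card[OF that] card[OF T] False fin[OF T] by simp
    moreover have "set_adj (F T) (F (insert x T))"
      using adj[OF T that] set_adj_insert[OF False] by simp
    moreover have "finite (F (insert x T))" using fin maps that by blast
    ultimately show ?thesis unfolding set_adj_def
      by (metis card_insert_disjoint finite_insert lessI not_less_iff_gr_or_eq subset_insertI less_SucI)
  qed (simp add: insert_absorb)
  have mono: "F T \<subseteq> F (T \<union> D)" if "finite D" "T \<union> D \<in> \<F>" for T D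
    using that
  proof (induction D rule: finite_induct)
    case (insert x D)
    have "T \<union> D \<in> \<F>" using down[OF insert.prems] by blast
    then show ?case using insert.IH step[of x "T \<union> D"] insert.prems by auto
  qed simp
  have sing: "{x} \<in> \<F>" if "x \<in> S" for x using down[OF S] that by blast
  have sub: "(\<Union>x\<in>S. F {x}) \<subseteq> F S"
  proof (rule UN_least)
    fix x assume "x \<in> S"
    then have "{x} \<union> S = S" by blast
    then show "F {x} \<subseteq> F S" using mono[of S "{x}"] fin[OF S] S by simp
  qed
  have "card (\<Union>x\<in>S. F {x}) = (\<Sum>x\<in>S. card (F {x}))"
  proof (rule card_UN_disjoint)
    show "\<forall>x\<in>S. finite (F {x})" using sing maps fin by blast
    show "\<forall>x\<in>S. \<forall>y\<in>S. x \<noteq> y \<longrightarrow> F {x} \<inter> F {y} = {}"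
    proof (intro ballI impI)
      fix x y assume xy: "x \<in> S" "y \<in> S" "x \<noteq> y"
      then have "F {x} \<noteq> F {y}" using bij sing by (auto simp: bij_betw_def dest: inj_onD)
      moreover obtain a b where "F {x} = {a}" "F {y} = {b}"
        using card[OF sing[OF xy(1)]] card[OF sing[OF xy(2)]] by (auto simp: card_1_singleton_iff)
      ultimately show "F {x} \<inter> F {y} = {}" by auto
    qed
  qed (rule fin[OF S])
  also have "\<dots> = card (F S)" using card sing S by simp
  finally show "F S = (\<Union>x\<in>S. F {x})"
    using card_subset_eq[OF fin[OF maps[OF S]] sub] by simp
qed

section \<open>Automorphisms on the independent sets of the cycle\<close>

lemma cyclic_sparse_sets_down: "S \<in> cyclic_sparse_sets n \<Longrightarrow> T \<subseteq> S \<Longrightarrow> T \<in> cyclic_sparse_sets n"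
  by (auto simp: cyclic_sparse_sets_def)

lemma cyclic_sparse_sets_finite: "S \<in> cyclic_sparse_sets n \<Longrightarrow> finite S"
  by (auto simp: cyclic_sparse_sets_def intro: finite_subset)

lemma cyclic_succ_neq:
  assumes "n \<ge> 2" "x \<in> {0..<int n}"
  shows "(x + 1) mod int n \<noteq> x"
proof (cases "x + 1 = int n")
  case True
  then show ?thesis using assms by auto
next
  case False
  then show ?thesis using assms by auto
qed

text \<open>The empty set is the only vertex of full degree.\<close>

lemma cyclic_sparse_sets_automorphism_empty:
  assumes n: "n \<ge> 2" and bij: "bij_betw F (cyclic_sparse_sets n) (cyclic_sparse_sets n)"
    and adj: "\<And>S T. S \<in> cyclic_sparse_sets n \<Longrightarrow> T \<in> cyclic_sparse_sets n \<Longrightarrow>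
      set_adj S T \<longleftrightarrow> set_adj (F S) (F T)"
  shows "F {} = {}"
proof (rule ccontr)
  let ?C = "cyclic_sparse_sets n"
  let ?V = "{0..<int n}"
  define S where "S = F {}"
  assume "F {} \<noteq> {}"
  then obtain x where x: "x \<in> S" by (auto simp: S_def)
  have e: "{} \<in> ?C" by (simp add: cyclic_sparse_sets_def)
  have S: "S \<in> ?C" using bij e by (auto simp: S_def bij_betw_def)
  \<comment> \<open>The successor \<open>y\<close> of the occupied position \<open>x\<close> can be
    neither removed from \<open>S\<close>, as it is not there, nor added without breaking sparsity.
    So \<open>S\<close> has at most \<open>n - 1\<close> neighbours, whereas the empty set has the
    \<open>n\<close> singletons.\<close>
  define y where "y = (x + 1) mod int n"
  have xV: "x \<in> ?V" using S x by (auto simp: cyclic_sparse_sets_def)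
  have y: "y \<in> ?V" "y \<noteq> x" using xV n cyclic_succ_neq[OF n xV] by (auto simp: y_def)
  have "(\<lambda>x. {x}) ` ?V \<subseteq> {T \<in> ?C. set_adj {} T}"
    using cyclic_succ_neq[OF n] by (auto simp: cyclic_sparse_sets_def set_adj_def)
  then have "F ` (\<lambda>x. {x}) ` ?V \<subseteq> {T \<in> ?C. set_adj S T}"
    using adj[OF e] bij by (auto simp: S_def bij_betw_def)
  also have "\<dots> \<subseteq> (\<lambda>z. if z \<in> S then S - {z} else insert z S) ` (?V - {y})"
  proof
    fix T assume "T \<in> {T \<in> ?C. set_adj S T}"
    then have T: "T \<in> ?C" "set_adj S T" by auto
    from T(2) consider z where "z \<notin> S" "T = insert z S" | z where "z \<notin> T" "S = insert z T"
      by (auto simp: set_adj_def)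
    then show "T \<in> (\<lambda>z. if z \<in> S then S - {z} else insert z S) ` (?V - {y})"
    proof cases
      case 1
      then have "z \<in> ?V" "z \<noteq> y" using T(1) x by (auto simp: cyclic_sparse_sets_def y_def)
      then show ?thesis using 1 by (intro image_eqI[of _ _ z]) auto
    next
      case 2
      then have "z \<in> ?V" "z \<noteq> y" using S x by (auto simp: cyclic_sparse_sets_def y_def)
      then show ?thesis using 2 by (intro image_eqI[of _ _ z]) auto
    qed
  qed
  finally have "card (F ` (\<lambda>x. {x}) ` ?V) \<le> card (?V - {y})"
    by (meson card_image_le card_mono finite_Diff finite_atLeastLessThan_int finite_imageI le_trans)
  moreover have "inj_on F ((\<lambda>x. {x}) ` ?V)"
  proof (rule inj_on_subset)
    show "inj_on F ?C" using bij by (simp add: bij_betw_def)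
    show "(\<lambda>x. {x}) ` ?V \<subseteq> ?C"
      using cyclic_succ_neq[OF n] by (auto simp: cyclic_sparse_sets_def)
  qed
  ultimately show False using y n by (simp add: card_image)
qed

text \<open>\<open>s\<close> lifts a map of the \<open>N\<close>-cycle to the integers. Two
  consecutive steps of opposite sign would give \<open>s (i + 2)\<close> and \<open>s i\<close> the
  same residue, against injectivity if \<open>N > 2\<close>; for \<open>N = 2\<close> the two signs
  agree modulo \<open>N\<close>. So the sign of the first step persists.\<close>

lemma cycle_automorphism_dihedral:
  fixes s :: "int \<Rightarrow> int"
  assumes N: "N \<ge> 2" and inj: "\<And>i j. N dvd s i - s j \<Longrightarrow> N dvd i - j"
    and step: "\<And>i. N dvd s (i + 1) - s i - 1 \<or> N dvd s (i + 1) - s i + 1"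
  obtains e where "e \<in> {1, - 1}" "\<And>i. N dvd s i - (s 0 + e * i)"
proof -
  obtain e where e: "e \<in> {1, - 1}" "\<And>i. N dvd s (i + 1) - s i - e"
  proof (cases "N = 2")
    case True
    have "N dvd s (i + 1) - s i - 1" for i
      using step[of i] unfolding True by presburger
    then show ?thesis using that[of 1] by simp
  next
    case False
    have "\<exists>e\<in>{1, - 1}. N dvd s (0 + 1) - s 0 - e" using step[of 0] by auto
    then obtain e where e: "e \<in> {1, - 1}" "N dvd s (0 + 1) - s 0 - e" by blast
    have iff: "N dvd s (i + 1) - s i - e \<longleftrightarrow> N dvd s (i + 1 + 1) - s (i + 1) - e" for i
    proof -
      have turn: False if "a \<in> {1, - 1}" "N dvd s (i + 1) - s i - a" "N dvd s (i + 1 + 1) - s (i + 1) + a" for a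
      proof -
        have "N dvd s (i + 1 + 1) - s i" using dvd_add[OF that(2,3)] by (simp add: algebra_simps)
        then have "N dvd 2" using inj[of "i + 1 + 1" i] by simp
        then show False using N False zdvd_imp_le[of N 2] by simp
      qed
      show ?thesis
        using e(1) step[of i] step[of "i + 1"] turn[of 1] turn[of "- 1"] by auto
    qed
    have "N dvd s (i + 1) - s i - e" for i
    proof (induction i rule: int_induct[of _ 0])
      case base
      show ?case by (rule e(2))
    next
      case (step1 i)
      then show ?case using iff[of i] by simp
    next
      case (step2 i)
      then show ?case using iff[of "i - 1"] by simp
    qed
    then show ?thesis using e(1) that by blast
  qed
  have "N dvd s i - (s 0 + e * i)" for i
  proof (induction i rule: int_induct[of _ 0])
    case (step1 i)
    then show ?case using dvd_add[OF step1(2) e(2)[of i]] by (simp add: algebra_simps)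
  next
    case (step2 i)
    then show ?case using dvd_diff[OF step2(2) e(2)[of "i - 1"]] by (simp add: algebra_simps)
  qed simp
  then show ?thesis using e(1) that by blast
qed

text \<open>On supports, \<open>G\<close> is induced by a permutation of the positions. Two distinct
  positions are adjacent on the cycle exactly if together they do not form a vertex, so the
  permutation preserves the cycle and is dihedral.\<close>

lemma lucas_seqs_automorphism_dihedral:
  assumes n: "n > 0" and bij: "bij_betw G (lucas_seqs n) (lucas_seqs n)"
    and adj: "\<And>f g. f \<in> lucas_seqs n \<Longrightarrow> g \<in> lucas_seqs n \<Longrightarrow>
      card {i \<in> {0..<int n}. f i \<noteq> g i} = 1 \<longleftrightarrow> card {i \<in> {0..<int n}. G f i \<noteq> G g i} = 1"
    and f: "f \<in> lucas_seqs n"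
  shows "G f \<in> dihedral_orbit f"
proof (cases "n = 1")
  case True
  \<comment> \<open>With period 1 every position has the value of its neighbour, so the zero word is
    the only one.\<close>
  have "\<not> g i" if "g \<in> lucas_seqs n" for g i
    using that True by (simp add: lucas_seqs_def) metis
  then have "G f = f" using f bij by (auto simp: bij_betw_def fun_eq_iff)
  then show ?thesis by (auto simp: dihedral_orbit_eq intro: range_eqI[of _ _ 0])
next
  case False
  then have n2: "n \<ge> 2" using n by simp
  define N where "N = int n"
  have N: "N \<ge> 2" using n2 by (simp add: N_def)
  let ?V = "{0..<N}"
  let ?C = "cyclic_sparse_sets n"
  define supp where "supp = (\<lambda>f. {i \<in> ?V. f i})"
  define per where "per = (\<lambda>S i. i mod N \<in> S)"
  \<comment> \<open>This is \<open>G\<close> transported to supports: \<open>per\<close> extends a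
    support periodically and \<open>supp\<close> reads off one period.\<close>
  define F where "F = supp \<circ> G \<circ> per"
  have bij_supp: "bij_betw supp (lucas_seqs n) ?C"
    using bij_betw_supp[OF n] by (simp add: supp_def N_def)
  have bij_per: "bij_betw per ?C (lucas_seqs n)"
    using bij_betw_periodic_extension[OF n] by (simp add: per_def N_def)
  have bijF: "bij_betw F ?C ?C"
    unfolding F_def by (intro bij_betw_trans[OF bij_per] bij_betw_trans[OF bij] bij_supp)
  have per_supp: "per (supp g) = g" if "g \<in> lucas_seqs n" for g
    using lucas_seqs_mod[OF that] N by (auto simp: per_def supp_def N_def)
  have supp_per: "supp (per S) = S" if "S \<in> ?C" for S
    using that by (auto simp: supp_def per_def cyclic_sparse_sets_def N_def)
  have supp_adj: "set_adj (supp g) (supp h) \<longleftrightarrow> card {i \<in> ?V. g i \<noteq> h i} = 1" for g h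
    unfolding set_adj_iff_card by (intro arg_cong[of _ _ "\<lambda>A. card A = 1"]) (auto simp: supp_def)
  have adjF: "set_adj S T \<longleftrightarrow> set_adj (F S) (F T)" if "S \<in> ?C" "T \<in> ?C" for S T
  proof -
    have "per S \<in> lucas_seqs n" "per T \<in> lucas_seqs n" using bij_per that by (auto simp: bij_betw_def)
    then show ?thesis
      using adj[of "per S" "per T"] supp_adj[of "per S" "per T"] supp_per that
      by (simp add: F_def supp_adj N_def)
  qed
  have emptyF: "F {} = {}"
    by (rule cyclic_sparse_sets_automorphism_empty[OF n2 bijF adjF])
  have aut: "card (F S) = card S" "F S = (\<Union>x\<in>S. F {x})" if "S \<in> ?C" for S
    by (rule down_closed_family_automorphism[of ?C F S, OF _ _ bijF _ emptyF that];
        (erule (1) cyclic_sparse_sets_down | erule cyclic_sparse_sets_finite | erule (1) adjF))+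
  have C_sub: "S \<subseteq> ?V" if "S \<in> ?C" for S using that by (simp add: cyclic_sparse_sets_def N_def)
  have maps: "F S \<in> ?C" if "S \<in> ?C" for S using bijF that by (auto simp: bij_betw_def)
  have sing: "{x} \<in> ?C" if "x \<in> ?V" for x
    using cyclic_succ_neq[OF n2, of x] that by (auto simp: cyclic_sparse_sets_def N_def)
  define \<sigma> where "\<sigma> x = the_elem (F {x})" for x
  have \<sigma>: "F {x} = {\<sigma> x}" if "x \<in> ?V" for x
  proof -
    have "card (F {x}) = 1" using aut(1)[OF sing[OF that]] by simp
    then obtain y where "F {x} = {y}" by (rule card_1_singletonE)
    then show ?thesis by (simp add: \<sigma>_def)
  qed
  have \<sigma>V: "\<sigma> x \<in> ?V" if "x \<in> ?V" for x
    using C_sub[OF maps[OF sing[OF that]]] \<sigma>[OF that] by simp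
  have inj: "inj_on \<sigma> ?V"
  proof (rule inj_onI)
    fix x y assume xy: "x \<in> ?V" "y \<in> ?V" "\<sigma> x = \<sigma> y"
    then have "F {x} = F {y}" using \<sigma> by simp
    then have "{x} = {y}" using inj_onD[OF bij_betw_imp_inj_on[OF bijF]] sing xy by blast
    then show "x = y" by simp
  qed
  have F_image: "F S = \<sigma> ` S" if "S \<in> ?C" for S
  proof -
    have "F S = (\<Union>x\<in>S. {\<sigma> x})"
      unfolding aut(2)[OF that] using C_sub[OF that] \<sigma> by (intro SUP_cong refl) blast
    then show ?thesis by auto
  qed
  have pair: "{x, y} \<notin> ?C \<longleftrightarrow> y = (x + 1) mod N \<or> x = (y + 1) mod N"
    if "x \<in> ?V" "y \<in> ?V" "x \<noteq> y" for x y
    using that cyclic_succ_neq[OF n2, of x] cyclic_succ_neq[OF n2, of y]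
    by (auto simp: cyclic_sparse_sets_def N_def)
  have edge: "\<sigma> y = (\<sigma> x + 1) mod N \<or> \<sigma> x = (\<sigma> y + 1) mod N"
    if x: "x \<in> ?V" and y: "y = (x + 1) mod N" for x y
  proof -
    have yV: "y \<in> ?V" "x \<noteq> y" using x y N cyclic_succ_neq[OF n2, of x] by (auto simp: N_def)
    have "{x, y} \<notin> ?C" using pair[OF x yV] y by simp
    \<comment> \<open>Surjectivity of \<open>F\<close> would provide a vertex with this image, and
      injectivity of \<open>\<sigma>\<close> identifies it with \<open>{x, y}\<close>, which is no
      vertex.\<close>
    have "{\<sigma> x, \<sigma> y} \<notin> ?C"
    proof
      assume "{\<sigma> x, \<sigma> y} \<in> ?C"
      then have "{\<sigma> x, \<sigma> y} \<in> F ` ?C" using bij_betw_imp_surj_on[OF bijF] by simp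
      then obtain T where T: "T \<in> ?C" "F T = {\<sigma> x, \<sigma> y}" by (metis imageE)
      then have "\<sigma> ` T = \<sigma> ` {x, y}" using F_image by simp
      then have "T = {x, y}" using inj_on_image_eq_iff[OF inj C_sub[OF T(1)], of "{x, y}"] x yV(1) by simp
      then show False using T(1) \<open>{x, y} \<notin> ?C\<close> by simp
    qed
    moreover have "\<sigma> x \<noteq> \<sigma> y" using inj_onD[OF inj _ x yV(1)] yV(2) by blast
    ultimately show ?thesis using pair[of "\<sigma> x" "\<sigma> y"] \<sigma>V x yV by simp
  qed
  \<comment> \<open>The periodic lift of \<open>\<sigma>\<close> to the integers. Its steps are 1 or
    -1 only modulo \<open>N\<close>, because of the wrap-around.\<close>
  define s where "s i = \<sigma> (i mod N)" for i
  have modV: "i mod N \<in> ?V" for i using N by simp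
  have step: "N dvd s (i + 1) - s i - 1 \<or> N dvd s (i + 1) - s i + 1" for i
  proof -
    have "s (i + 1) = (s i + 1) mod N \<or> s i = (s (i + 1) + 1) mod N"
      unfolding s_def by (rule edge[OF modV]) (simp add: mod_add_left_eq)
    moreover have "N dvd (s j + 1) mod N - (s j + 1)" for j
      by (simp add: mod_eq_dvd_iff[symmetric])
    ultimately have "N dvd s (i + 1) - (s i + 1) \<or> N dvd s i - (s (i + 1) + 1)"
      by metis
    moreover have "N dvd s i - (s (i + 1) + 1) \<longleftrightarrow> N dvd s (i + 1) - s i + 1"
      using dvd_minus_iff[of N "s (i + 1) - s i + 1"] by (simp add: algebra_simps)
    ultimately show ?thesis by (simp add: algebra_simps)
  qed
  have inj_s: "N dvd i - j" if "N dvd s i - s j" for i j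
  proof -
    have "s i mod N = s j mod N" using that by (simp add: mod_eq_dvd_iff)
    then have "s i = s j" using \<sigma>V[OF modV] by (simp add: s_def)
    then have "i mod N = j mod N" unfolding s_def by (rule inj_onD[OF inj _ modV modV])
    then show ?thesis by (simp add: mod_eq_dvd_iff)
  qed
  obtain e where e: "e \<in> {1, - 1}" "\<And>i. N dvd s i - (s 0 + e * i)"
    using cycle_automorphism_dihedral[of N s, OF N inj_s step] by blast
  have Gf: "G f \<in> lucas_seqs n" using bij f by (auto simp: bij_betw_def)
  have "supp f \<in> ?C" using bij_supp f by (auto simp: bij_betw_def)
  then have supp_Gf: "supp (G f) = \<sigma> ` supp f"
    using F_image[of "supp f"] per_supp[OF f] by (simp add: F_def)
  have "G f (s 0 + e * i) = f i" for i
  proof -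
    have "G f (s 0 + e * i) = G f (s i)"
      by (rule lucas_seqs_cong[OF Gf]) (use e(2)[of i] in \<open>simp add: N_def dvd_diff_commute\<close>)
    also have "\<dots> \<longleftrightarrow> s i \<in> supp (G f)" using \<sigma>V[OF modV] by (simp add: supp_def s_def)
    also have "\<dots> \<longleftrightarrow> i mod N \<in> supp f"
      unfolding supp_Gf s_def by (rule inj_on_image_mem_iff[OF inj modV]) (auto simp: supp_def)
    also have "\<dots> \<longleftrightarrow> f i" using modV lucas_seqs_mod[OF f] by (simp add: supp_def N_def)
    finally show ?thesis .
  qed
  note Gf_eq = this
  \<comment> \<open>The substitution is the inverse of \<open>i \<mapsto> s 0 + e * i\<close>, by
    \<open>e * e = 1\<close>.\<close>
  have "G f = (\<lambda>j. f (e * j + - e * s 0))"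
  proof
    fix j
    have "s 0 + e * (e * j + - e * s 0) = j" using e(1) by auto
    then show "G f j = f (e * j + - e * s 0)" using Gf_eq[of "e * j + - e * s 0"] by simp
  qed
  then show ?thesis using e(1) unfolding dihedral_orbit_def by blast
qed

section \<open>Lucas strings as periodic words\<close>

definition word_seq :: "bool list \<Rightarrow> int \<Rightarrow> bool" where
  "word_seq u i = u ! nat (i mod int (length u))"

text \<open>In the periodic extension position \<open>n\<close> carries the digit
  \<open>u ! 0\<close>, so the condition on the first and last digit of a Lucas string is the
  adjacency condition at \<open>n - 1\<close> and \<open>n\<close>.\<close>

lemma bij_betw_word_seq:
  assumes n: "n > 0"
  shows "bij_betw word_seq (lucas_strings n) (lucas_seqs n)"
proof (rule bij_betw_byWitness[where f' = "\<lambda>f. map (\<lambda>i. f (int i)) [0..<n]"])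
  show "\<forall>u\<in>lucas_strings n. map (\<lambda>i. word_seq u (int i)) [0..<n] = u"
    by (auto simp: lucas_strings_def word_seq_def intro: nth_equalityI)
  show "\<forall>f\<in>lucas_seqs n. word_seq (map (\<lambda>i. f (int i)) [0..<n]) = f"
  proof (intro ballI ext)
    fix f i assume f: "f \<in> lucas_seqs n"
    have "nat (i mod int n) < n" using n by (simp add: nat_less_iff)
    then show "word_seq (map (\<lambda>i. f (int i)) [0..<n]) i = f i"
      using n lucas_seqs_mod[OF f] by (simp add: word_seq_def)
  qed
  show "word_seq ` lucas_strings n \<subseteq> lucas_seqs n"
  proof
    fix f assume "f \<in> word_seq ` lucas_strings n"
    then obtain u where u: "u \<in> lucas_strings n" "f = word_seq u" by blast
    have "\<not> (f i \<and> f (i + 1))" for i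
    proof -
      define r where "r = nat (i mod int n)"
      have r: "i mod int n = int r" "r < n" using n by (simp_all add: r_def nat_less_iff)
      have "(i + 1) mod int n = (int r + 1) mod int n"
        unfolding r(1)[symmetric] by (simp add: mod_add_left_eq)
      also have "int r + 1 = int (Suc r)" by simp
      also have "int (Suc r) mod int n = (if Suc r = n then 0 else int (Suc r))" using r(2)
        by (cases "Suc r = n") auto
      finally have "(i + 1) mod int n = (if Suc r = n then 0 else int (Suc r))" .
      then have "f (i + 1) = (if Suc r = n then u ! 0 else u ! Suc r)" "f i = u ! r"
        using u r(1)
        by (cases "Suc r = n"; simp only: word_seq_def lucas_strings_def mem_Collect_eq nat_int nat_0 if_True if_False)+
      moreover have "r = n - 1" if "Suc r = n" using that by simp
      ultimately show ?thesis using u(1) r(2) by (auto simp: lucas_strings_def Suc_lessI)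
    qed
    then show "f \<in> lucas_seqs n" using u by (simp add: lucas_seqs_def word_seq_def lucas_strings_def)
  qed
  show "(\<lambda>f. map (\<lambda>i. f (int i)) [0..<n]) ` lucas_seqs n \<subseteq> lucas_strings n"
  proof
    fix u assume "u \<in> (\<lambda>f. map (\<lambda>i. f (int i)) [0..<n]) ` lucas_seqs n"
    then obtain f where f: "f \<in> lucas_seqs n" "u = map (\<lambda>i. f (int i)) [0..<n]" by blast
    have "f (int (n - 1) + 1) = f 0" by (rule lucas_seqs_cong[OF f(1)]) (use n in simp)
    then have "\<not> (f 0 \<and> f (int (n - 1)))" using lucas_seqs_sparse[OF f(1), of "int (n - 1)"] by blast
    moreover have "\<not> (f (int i) \<and> f (int (Suc i)))" for i
      using lucas_seqs_sparse[OF f(1), of "int i"] by (simp add: add.commute)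
    ultimately show "u \<in> lucas_strings n" using n f by (auto simp: lucas_strings_def)
  qed
qed

lemma verts_lucas_cube: "verts (lucas_cube n) = lucas_strings n"
  by (simp add: lucas_cube_def hypercube_def)

lemma adj_lucas_cube:
  assumes "u \<in> lucas_strings n" "v \<in> lucas_strings n"
  shows "u \<rightarrow>\<^bsub>lucas_cube n\<^esub> v \<longleftrightarrow> card {i \<in> {0..<int n}. word_seq u i \<noteq> word_seq v i} = 1"
proof -
  have len: "length u = n" "length v = n" using assms by (auto simp: lucas_strings_def)
  have "{i \<in> {0..<int n}. word_seq u i \<noteq> word_seq v i} = int ` {i. i < n \<and> u ! i \<noteq> v ! i}"
  proof (intro equalityI subsetI)
    fix i assume "i \<in> {i \<in> {0..<int n}. word_seq u i \<noteq> word_seq v i}"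
    then show "i \<in> int ` {i. i < n \<and> u ! i \<noteq> v ! i}"
      using len by (intro image_eqI[of _ _ "nat i"]) (auto simp: word_seq_def)
  qed (auto simp: word_seq_def len)
  then have "card {i \<in> {0..<int n}. word_seq u i \<noteq> word_seq v i} = card {i. i < n \<and> u ! i \<noteq> v ! i}"
    by (simp add: card_image)
  moreover have "u \<rightarrow>\<^bsub>lucas_cube n\<^esub> v \<longleftrightarrow> (u, v) \<in> arcs (lucas_cube n)"
    by (simp add: arcs_ends_conv lucas_cube_def hypercube_def)
  ultimately show ?thesis using assms len by (simp add: arcs_lucas_cube)
qed

lemma dihedral_map_lucas_seqs:
  assumes e: "e \<in> {1, - 1}" and f: "f \<in> lucas_seqs n"
  shows "(\<lambda>i. f (e * i + t)) \<in> lucas_seqs n"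
proof -
  have "f (e * (i + int n) + t) = f (e * i + t)" for i
    by (rule lucas_seqs_cong[OF f]) (simp add: algebra_simps)
  moreover have "\<not> (f (e * i + t) \<and> f (e * (i + 1) + t))" for i
    using e lucas_seqs_sparse[OF f, of "i + t"] lucas_seqs_sparse[OF f, of "t - i - 1"]
    by (auto simp: algebra_simps)
  ultimately show ?thesis by (simp add: lucas_seqs_def)
qed

lemma bij_betw_dihedral_map:
  assumes e: "e \<in> {1, - 1 :: int}"
  shows "bij_betw (\<lambda>f i. f (e * i + t)) (lucas_seqs n) (lucas_seqs n)"
proof (rule bij_betw_byWitness[where f' = "\<lambda>f i. f (e * i + - e * t)"])
  have *: "e * (e * i + - e * t) + t = i" "e * (e * i + t) + - e * t = i" for i
    using e by auto
  show "\<forall>f\<in>lucas_seqs n. (\<lambda>i. f (e * (e * i + - e * t) + t)) = f"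
    "\<forall>f\<in>lucas_seqs n. (\<lambda>i. f (e * (e * i + t) + - e * t)) = f"
    unfolding * by simp_all
qed (use dihedral_map_lucas_seqs[OF e] in blast)+

text \<open>The map \<open>i \<mapsto> e * i + t\<close> permutes the residues modulo
  \<open>n\<close>, so the Hamming distance over one period is preserved.\<close>

lemma card_diff_dihedral_map:
  assumes e: "e \<in> {1, - 1 :: int}" and f: "f \<in> lucas_seqs n" and g: "g \<in> lucas_seqs n" and n: "n > 0"
  shows "card {i \<in> {0..<int n}. f (e * i + t) \<noteq> g (e * i + t)} = card {i \<in> {0..<int n}. f i \<noteq> g i}"
proof -
  have "bij_betw (\<lambda>i. (e * i + t) mod int n)
    {i \<in> {0..<int n}. f (e * i + t) \<noteq> g (e * i + t)} {i \<in> {0..<int n}. f i \<noteq> g i}"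
  proof (rule bij_betw_byWitness[where f' = "\<lambda>i. (e * (i - t)) mod int n"])
    have 1: "(e * ((e * i + t) mod int n - t)) mod int n = i mod int n" for i
    proof -
      have "(e * ((e * i + t) mod int n - t)) mod int n = (e * ((e * i + t) - t)) mod int n"
        by (metis mod_diff_left_eq mod_mult_right_eq)
      also have "e * ((e * i + t) - t) = i" using e by auto
      finally show ?thesis .
    qed
    have 2: "(e * (e * (i - t) mod int n) + t) mod int n = i mod int n" for i
    proof -
      have "(e * (e * (i - t) mod int n) + t) mod int n = (e * (e * (i - t)) + t) mod int n"
        by (metis mod_add_left_eq mod_mult_right_eq)
      also have "e * (e * (i - t)) + t = i" using e by auto
      finally show ?thesis .
    qed
    have 3: "h (e * (e * (i - t) mod int n) + t) = h i" if "h \<in> lucas_seqs n" for h i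
      by (rule lucas_seqs_cong[OF that]) (simp add: 2 mod_eq_dvd_iff[symmetric])
    show "\<forall>i\<in>{i \<in> {0..<int n}. f (e * i + t) \<noteq> g (e * i + t)}.
        (e * ((e * i + t) mod int n - t)) mod int n = i"
      by (simp add: 1)
    show "\<forall>i\<in>{i \<in> {0..<int n}. f i \<noteq> g i}. (e * (e * (i - t) mod int n) + t) mod int n = i"
      by (simp add: 2)
    show "(\<lambda>i. (e * i + t) mod int n) ` {i \<in> {0..<int n}. f (e * i + t) \<noteq> g (e * i + t)}
        \<subseteq> {i \<in> {0..<int n}. f i \<noteq> g i}"
      using n by (auto simp: lucas_seqs_mod[OF f] lucas_seqs_mod[OF g])
    show "(\<lambda>i. (e * (i - t)) mod int n) ` {i \<in> {0..<int n}. f i \<noteq> g i}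
        \<subseteq> {i \<in> {0..<int n}. f (e * i + t) \<noteq> g (e * i + t)}"
      using n by (auto simp: 3[OF f] 3[OF g])
  qed
  then show ?thesis by (rule bij_betw_same_card)
qed

text \<open>An automorphism transported along \<open>word_seq\<close> moves each word within its
  dihedral orbit, by \<open>lucas_seqs_automorphism_dihedral\<close>. Conversely, a dihedral
  substitution permutes the words and preserves Hamming distance, so it comes from an
  automorphism.\<close>

lemma orbit_lucas_cube:
  assumes n: "n > 0" and u: "u \<in> lucas_strings n"
  shows "word_seq ` orbit (graph_aut_group (lucas_cube n)) (\<lambda>f. f) u = dihedral_orbit (word_seq u)"
proof -
  let ?L = "lucas_strings n" and ?W = word_seq and ?I = "inv_into (lucas_strings n) word_seq"
  note bij = bij_betw_word_seq[OF n]
  have W: "?W v \<in> lucas_seqs n" if "v \<in> ?L" for v using bij that by (auto simp: bij_betw_def)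
  have bijI: "bij_betw ?I (lucas_seqs n) ?L" by (rule bij_betw_inv_into[OF bij])
  have I: "?I f \<in> ?L" if "f \<in> lucas_seqs n" for f using bijI that by (auto simp: bij_betw_def)
  have WI: "?W (?I f) = f" if "f \<in> lucas_seqs n" for f using bij_betw_inv_into_right[OF bij that] .
  have IW: "?I (?W v) = v" if "v \<in> ?L" for v using bij_betw_inv_into_left[OF bij that] .
  have orbit: "orbit (graph_aut_group (lucas_cube n)) (\<lambda>f. f) u = {g u |g. g \<in> graph_auts (lucas_cube n)}"
    by (simp add: orbit_def graph_aut_group_def)
  have auts: "g \<in> graph_auts (lucas_cube n) \<longleftrightarrow> g \<in> extensional ?L \<and> bij_betw g ?L ?L \<and>
      (\<forall>u\<in>?L. \<forall>v\<in>?L. card {i \<in> {0..<int n}. ?W u i \<noteq> ?W v i} = 1 \<longleftrightarrow>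
        card {i \<in> {0..<int n}. ?W (g u) i \<noteq> ?W (g v) i} = 1)" for g
    by (auto simp: graph_auts_def verts_lucas_cube Bij_def adj_lucas_cube bij_betw_apply)
  show ?thesis
  proof (intro equalityI subsetI)
    fix f assume "f \<in> ?W ` orbit (graph_aut_group (lucas_cube n)) (\<lambda>f. f) u"
    then obtain g where g: "g \<in> graph_auts (lucas_cube n)" "f = ?W (g u)" unfolding orbit by blast
    have "(?W \<circ> g \<circ> ?I) (?W u) \<in> dihedral_orbit (?W u)"
    proof (rule lucas_seqs_automorphism_dihedral[OF n _ _ W[OF u]])
      show "bij_betw (?W \<circ> g \<circ> ?I) (lucas_seqs n) (lucas_seqs n)"
        using g(1) unfolding auts by (intro bij_betw_trans[OF bijI] bij_betw_trans[OF _ bij]) blast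
    next
      fix f h assume fh: "f \<in> lucas_seqs n" "h \<in> lucas_seqs n"
      have "card {i \<in> {0..<int n}. ?W (?I f) i \<noteq> ?W (?I h) i} = 1 \<longleftrightarrow>
        card {i \<in> {0..<int n}. ?W (g (?I f)) i \<noteq> ?W (g (?I h)) i} = 1"
        using g(1) I[OF fh(1)] I[OF fh(2)] unfolding auts by blast
      then show "card {i \<in> {0..<int n}. f i \<noteq> h i} = 1 \<longleftrightarrow>
        card {i \<in> {0..<int n}. (?W \<circ> g \<circ> ?I) f i \<noteq> (?W \<circ> g \<circ> ?I) h i} = 1"
        by (simp add: WI[OF fh(1)] WI[OF fh(2)])
    qed
    then show "f \<in> dihedral_orbit (?W u)" using g(2) IW[OF u] by simp
  next
    fix f assume "f \<in> dihedral_orbit (?W u)"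
    then obtain e t where et: "e \<in> {1, - 1}" "f = (\<lambda>i. ?W u (e * i + t))"
      unfolding dihedral_orbit_def by blast
    define h where "h = (\<lambda>(f :: int \<Rightarrow> bool) i. f (e * i + t))"
    have bijh: "bij_betw h (lucas_seqs n) (lucas_seqs n)"
      unfolding h_def by (rule bij_betw_dihedral_map[OF et(1)])
    have h: "h f \<in> lucas_seqs n" if "f \<in> lucas_seqs n" for f using bijh that by (auto simp: bij_betw_def)
    \<comment> \<open>The restriction makes \<open>g\<close> undefined outside the vertices, as
      membership in \<open>graph_auts\<close> demands.\<close>
    define g where "g = restrict (?I \<circ> h \<circ> ?W) ?L"
    have g_eq: "?W (g v) = h (?W v)" if "v \<in> ?L" for v
      using that by (simp add: g_def WI h W)
    have "g \<in> graph_auts (lucas_cube n)"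
      unfolding auts
    proof (intro conjI ballI)
      show "g \<in> extensional ?L" by (simp add: g_def)
      have "bij_betw (?I \<circ> h \<circ> ?W) ?L ?L"
        by (intro bij_betw_trans[OF bij] bij_betw_trans[OF bijh] bijI)
      then show "bij_betw g ?L ?L" by (rule bij_betw_cong[THEN iffD1, rotated]) (simp add: g_def)
    next
      fix v w assume vw: "v \<in> ?L" "w \<in> ?L"
      show "card {i \<in> {0..<int n}. ?W v i \<noteq> ?W w i} = 1 \<longleftrightarrow>
        card {i \<in> {0..<int n}. ?W (g v) i \<noteq> ?W (g w) i} = 1"
        using card_diff_dihedral_map[OF et(1) W[OF vw(1)] W[OF vw(2)] n]
        by (simp add: g_eq vw h_def)
    qed
    moreover have "f = ?W (g u)" using et(2) g_eq[OF u] by (simp add: h_def)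
    ultimately show "f \<in> ?W ` orbit (graph_aut_group (lucas_cube n)) (\<lambda>f. f) u"
      unfolding orbit by blast
  qed
qed

section \<open>Counting orbits by size\<close>

lemma (in group_action) num_orbits_of_size:
  assumes fin: "finite E"
  shows "k * card {X \<in> orbits G E \<phi>. card X = k} = card {x \<in> E. card (orbit G \<phi> x) = k}"
proof -
  have part: "partition E (orbits G E \<phi>)" by (rule orbit_partition)
  have un: "\<Union> (orbits G E \<phi>) = E" using partition.partition_coverture[OF part] .
  have same: "orbit G \<phi> x = X" if "X \<in> orbits G E \<phi>" "x \<in> X" for x X
  proof -
    have "x \<in> E" using that un by blast
    then have "orbit G \<phi> x \<in> orbits G E \<phi>" "x \<in> orbit G \<phi> x"
      by (auto simp: orbits_def orbit_refl)
    then show ?thesis using partition.unique_class[OF part \<open>x \<in> E\<close>] that by blast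
  qed
  have Un: "\<Union> {X \<in> orbits G E \<phi>. card X = k} = {x \<in> E. card (orbit G \<phi> x) = k}"
  proof (intro equalityI subsetI)
    fix x assume "x \<in> \<Union> {X \<in> orbits G E \<phi>. card X = k}"
    then show "x \<in> {x \<in> E. card (orbit G \<phi> x) = k}" using same un by blast
  next
    fix x assume x: "x \<in> {x \<in> E. card (orbit G \<phi> x) = k}"
    then have "orbit G \<phi> x \<in> orbits G E \<phi>" "x \<in> orbit G \<phi> x"
      by (auto simp: orbits_def orbit_refl)
    then show "x \<in> \<Union> {X \<in> orbits G E \<phi>. card X = k}" using x by blast
  qed
  have "finite (orbits G E \<phi>)" using fin un by (metis finite_UnionD)
  then have "k * card {X \<in> orbits G E \<phi>. card X = k} = card (\<Union> {X \<in> orbits G E \<phi>. card X = k})"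
  proof (intro card_partition)
    show "finite (\<Union> {X \<in> orbits G E \<phi>. card X = k})" using fin by (simp add: Un)
    show "X \<inter> Y = {}" if "X \<in> {X \<in> orbits G E \<phi>. card X = k}"
      "Y \<in> {X \<in> orbits G E \<phi>. card X = k}" "X \<noteq> Y" for X Y
      using that same by blast
  qed auto
  then show ?thesis by (simp only: Un)
qed

text \<open>\<open>word_seq\<close> is injective and maps vertex orbits onto dihedral orbits, so
  orbit sizes can be read off from the words.\<close>

lemma num_vertex_orbits_lucas_cube:
  assumes n: "n > 0"
  shows "k * num_vertex_orbits (lucas_cube n) k = card {f \<in> lucas_seqs n. card (dihedral_orbit f) = k}"
proof -
  let ?L = "lucas_strings n"
  let ?orb = "orbit (graph_aut_group (lucas_cube n)) (\<lambda>f. f)"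
  interpret group_action "graph_aut_group (lucas_cube n)" ?L "\<lambda>f. f"
    using group_action_graph_aut_group[of "lucas_cube n"] by (simp add: verts_lucas_cube)
  note bij = bij_betw_word_seq[OF n]
  have fin: "finite ?L" using bij_betw_finite[OF bij] finite_lucas_seqs[OF n] by simp
  have card_orb: "card (?orb u) = card (dihedral_orbit (word_seq u))" if u: "u \<in> ?L" for u
  proof -
    have "?orb u \<subseteq> ?L" using u element_image by (auto simp: orbit_def)
    then have "inj_on word_seq (?orb u)" using bij_betw_imp_inj_on[OF bij] inj_on_subset by blast
    then have "card (word_seq ` ?orb u) = card (?orb u)" by (rule card_image)
    then show ?thesis by (simp add: orbit_lucas_cube[OF n u])
  qed
  have "k * num_vertex_orbits (lucas_cube n) k = card {u \<in> ?L. card (?orb u) = k}"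
    unfolding num_vertex_orbits_def verts_lucas_cube by (rule num_orbits_of_size[OF fin])
  also have "{u \<in> ?L. card (?orb u) = k} = {u \<in> ?L. card (dihedral_orbit (word_seq u)) = k}"
    using card_orb by auto
  also have "card \<dots> = card (word_seq ` \<dots>)"
    by (rule card_image[symmetric]) (rule inj_on_subset[OF bij_betw_imp_inj_on[OF bij]], blast)
  also have "word_seq ` {u \<in> ?L. card (dihedral_orbit (word_seq u)) = k}
      = {f \<in> lucas_seqs n. card (dihedral_orbit f) = k}"
    unfolding bij_betw_imp_surj_on[OF bij, symmetric] by auto
  finally show ?thesis .
qed

theorem theorem5p8:
  fixes n k :: nat
  assumes "n > 0" and "k dvd 2 * n"
  shows "real (num_vertex_orbits (lucas_cube n) k) =
    (if k dvd n \<and> odd k then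
       (\<Sum>d | d dvd k. real_of_int (moebius_mu (k div d)) * real (fib (d div 2 + 2)))
     else if k dvd n \<and> even k then
       (\<Sum>d | d dvd k. real_of_int (moebius_mu (k div d)) * real (fib (d div 2 + 2)))
       + 1 / real k * (\<Sum>d | d dvd k div 2. real_of_int (moebius_mu (k div (2 * d))) *
           (real (lucas d) - real k / 2 * real (fib (d div 2 + 2))))
     else
       1 / real k * (\<Sum>d | d dvd k div 2. real_of_int (moebius_mu (k div (2 * d))) *
           (real (lucas d) - real k / 2 * real (fib (d div 2 + 2)))))"
proof -
  have k: "k > 0" using assms dvd_pos_nat[of "2 * n" k] by simp
  \<comment> \<open>An odd \<open>k\<close> dividing \<open>2 * n\<close> divides \<open>n\<close>,
    so the last case of the formula concerns even \<open>k\<close> only, where halving is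
    exact.\<close>
  have even: "even k" if "\<not> k dvd n"
  proof (rule ccontr)
    assume "odd k"
    then have "coprime k 2" by simp
    then show False using assms(2) that by (simp add: coprime_dvd_mult_right_iff)
  qed
  let ?a = "\<Sum>d | d dvd k. real_of_int (moebius_mu (k div d)) * real (fib (d div 2 + 2))"
  let ?c = "\<Sum>d | d dvd k div 2. real_of_int (moebius_mu (k div (2 * d))) *
    (real (lucas d) - real k / 2 * real (fib (d div 2 + 2)))"
  \<comment> \<open>These are the chiral words of least period \<open>k div 2\<close>. Achiral words
    form a subset of the primitive ones, so the natural subtraction is exact and passes to the
    reals.\<close>
  have chiral: "real (card (primitive_seqs (k div 2)) - card (achiral_seqs (k div 2))) = ?c" if "even k"
  proof -
    have k2: "k div 2 > 0" using k that by auto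
    have "card (achiral_seqs (k div 2)) \<le> card (primitive_seqs (k div 2))"
      using finite_primitive_seqs[OF k2] by (intro card_mono) (auto simp: achiral_seqs_def)
    then have "real (card (primitive_seqs (k div 2)) - card (achiral_seqs (k div 2)))
      = real (card (primitive_seqs (k div 2))) - real (card (achiral_seqs (k div 2)))"
      by simp
    also have "\<dots> = (\<Sum>d | d dvd k div 2. real_of_int (moebius_mu (k div 2 div d)) *
        (real (lucas d) - real (k div 2) * real (fib (d div 2 + 2))))"
      unfolding card_primitive_seqs[OF k2] card_achiral_seqs[OF k2]
      by (simp add: sum_distrib_left right_diff_distrib sum_subtractf mult.left_commute)
    also have "\<dots> = ?c" using that by (simp add: real_of_nat_div flip: div_mult2_eq)
    finally show ?thesis .
  qed
  have "real k * real (num_vertex_orbits (lucas_cube n) k)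
      = real (card {f \<in> lucas_seqs n. card (dihedral_orbit f) = k})"
    by (simp only: num_vertex_orbits_lucas_cube[OF assms(1), symmetric] of_nat_mult)
  \<comment> \<open>The achiral count is \<open>k\<close> times a divisor sum, so this factor
    cancels against the orbit size, while the chiral count keeps the division by
    \<open>k\<close>.\<close>
  also have "\<dots> = (if k dvd n then real k * ?a else 0) + (if even k then ?c else 0)"
    unfolding card_lucas_seqs_orbit_size[OF assms] of_nat_add
    using chiral card_achiral_seqs[OF k] by simp
  finally have eq: "real k * real (num_vertex_orbits (lucas_cube n) k)
      = (if k dvd n then real k * ?a else 0) + (if even k then ?c else 0)" .
  show ?thesis
  proof (cases "k dvd n")
    case True
    then show ?thesis using eq k by (cases "even k") (simp_all add: field_simps)
  next
    case False
    then show ?thesis using eq k even by (simp add: field_simps)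
  qed
qed

end
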